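(* Let $(\mathbb{H}^{n},g_{-1})$ be the $n$-dimensional hyperbolic space, with $n\geq 3$, whose metric is given by $(g_{-1})_{ij}=\delta_{ij}/x_{n}^{2}$. Consider the warped product manifold $M=(\mathbb{H}^{n},g_{-1})\times_{f}F^{d}$, where $F^{d}$ is a Riemannian Einstein manifold with constant Ricci curvature $\lambda_{F}$. Then $M$ is an Einstein manifold with constant Ricci curvature $\lambda<0$ if and only if $$f=\frac{1}{x_{n}}\sum_{j=1}^{n-1}\left(\frac{a}{2}x_{j}^{2}+b_{j}x_{j}+c_{j}\right)+\frac{a}{2}x_{n}+\frac{b}{x_{n}},$$ where $a$, $b$, $b_{j}$ and $c_{j}$, for $j=1,\ldots,n-1$, are constants.
   Context: $\mathbb{H}^{n}=\{x=(x_{1},\ldots,x_{n})\in\mathbb{R}^{n}: x_{n}>0\}$. A Riemannian manifold $(N,h)$ is Einstein with constant Ricci curvature $\mu\in\mathbb{R}$ if $\mathrm{Ric}_h=\mu h$. For manifolds $(B,g_B)$, $(F^d,g_F)$, with $d=\dim F$, and a smooth function $f>0$ on $B$, the warped product $B\times_f F$ is the product manifold $B\times F$ with the metric $g_B+f^2g_F$ (pullbacks under the projections understood). When $d=1$, $\lambda_F=0$.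
   Formalization: As stated it fails for d≥2 (f=1/x_n with F a round sphere; constant f with λ_F=-(n-1)f²), so the formal version assumes f non-constant when λ_F<0 and adds to the form of f the relation λ_F=(d-1)(Σb_j²-2a(b+Σc_j)). *)

theory Defs
  imports "HOL-Analysis.Analysis"
begin

section \<open>Smooth functions on open subsets of Euclidean space\<close>

definition partial_deriv :: "'m::finite \<Rightarrow> (real^'m \<Rightarrow> real) \<Rightarrow> real^'m \<Rightarrow> real" where
  "partial_deriv i h y = frechet_derivative h (at y) (axis i 1)"

text \<open>Meaningful for open \<open>S\<close> only.\<close>

fun Ck_on :: "nat \<Rightarrow> (real^'m::finite \<Rightarrow> real) \<Rightarrow> (real^'m) set \<Rightarrow> bool" where
  "Ck_on 0 h S \<longleftrightarrow> continuous_on S h"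
| "Ck_on (Suc k) h S \<longleftrightarrow>
     (\<forall>y\<in>S. h differentiable (at y)) \<and> (\<forall>i. Ck_on k (partial_deriv i h) S)"

definition smooth_on :: "(real^'m::finite) set \<Rightarrow> (real^'m \<Rightarrow> real) \<Rightarrow> bool" where
  "smooth_on S h \<longleftrightarrow> (\<forall>k. Ck_on k h S)"


section \<open>Riemannian manifolds\<close>

text \<open>
  The charts of an atlas are named by the elements of an index set \<open>charts\<close>; the chart \<open>c\<close> is the
  map \<open>coord c\<close> on the open set \<open>cdom c\<close>.  The Riemannian metric is given by its component matrices:
  \<open>metric c p $ i $ j\<close> is \<open>g(\<partial>\<^sub>i, \<partial>\<^sub>j)\<close> at the point \<open>p\<close> for the coordinate fields of the chart \<open>c\<close>.
\<close>

record ('p, 'c, 'm) riemannian =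
  mspace :: "'p topology"
  charts :: "'c set"
  cdom   :: "'c \<Rightarrow> 'p set"
  coord  :: "'c \<Rightarrow> 'p \<Rightarrow> real^'m"
  metric :: "'c \<Rightarrow> 'p \<Rightarrow> real^'m^'m"

definition cimage :: "('p, 'c, 'm::finite) riemannian \<Rightarrow> 'c \<Rightarrow> (real^'m) set" where
  "cimage M c = coord M c ` cdom M c"

definition cinv :: "('p, 'c, 'm::finite) riemannian \<Rightarrow> 'c \<Rightarrow> real^'m \<Rightarrow> 'p" where
  "cinv M c = inv_into (cdom M c) (coord M c)"

definition transition ::
  "('p, 'c, 'm::finite) riemannian \<Rightarrow> 'c \<Rightarrow> 'c \<Rightarrow> real^'m \<Rightarrow> real^'m" where
  "transition M c c' = (\<lambda>y. coord M c' (cinv M c y))"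

definition local_metric ::
  "('p, 'c, 'm::finite) riemannian \<Rightarrow> 'c \<Rightarrow> real^'m \<Rightarrow> real^'m^'m" where
  "local_metric M c = (\<lambda>y. metric M c (cinv M c y))"

definition smooth_manifold :: "('p, 'c, 'm::finite) riemannian \<Rightarrow> bool" where
  "smooth_manifold M \<longleftrightarrow>
     topspace (mspace M) \<noteq> {} \<and> Hausdorff_space (mspace M) \<and> second_countable (mspace M) \<and>
     (\<Union>c\<in>charts M. cdom M c) = topspace (mspace M) \<and>
     (\<forall>c\<in>charts M.
        openin (mspace M) (cdom M c) \<and> open (cimage M c) \<and>
        homeomorphic_map (subtopology (mspace M) (cdom M c)) (top_of_set (cimage M c)) (coord M c)) \<and>
     (\<forall>c\<in>charts M. \<forall>c'\<in>charts M. \<forall>i.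
        smooth_on (coord M c ` (cdom M c \<inter> cdom M c')) (\<lambda>y. transition M c c' y $ i))"

definition riemannian_manifold :: "('p, 'c, 'm::finite) riemannian \<Rightarrow> bool" where
  "riemannian_manifold M \<longleftrightarrow>
     smooth_manifold M \<and>
     (\<forall>c\<in>charts M. \<forall>i j. smooth_on (cimage M c) (\<lambda>y. local_metric M c y $ i $ j)) \<and>
     (\<forall>c\<in>charts M. \<forall>p\<in>cdom M c.
        transpose (metric M c p) = metric M c p \<and>
        (\<forall>v. v \<noteq> 0 \<longrightarrow> v \<bullet> (metric M c p *v v) > 0)) \<and>
     (\<forall>c\<in>charts M. \<forall>c'\<in>charts M. \<forall>p \<in> cdom M c \<inter> cdom M c'.
        let J = jacobian (transition M c c') (at (coord M c p))
        in metric M c p = transpose J ** metric M c' p ** J)"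


section \<open>Ricci curvature\<close>

text \<open>\<open>christoffel G k i j\<close> is \<open>\<Gamma>\<^sup>k\<^sub>i\<^sub>j\<close> for the metric components \<open>G\<close> in some coordinates.\<close>

definition christoffel ::
  "(real^'m \<Rightarrow> real^'m^'m) \<Rightarrow> 'm::finite \<Rightarrow> 'm \<Rightarrow> 'm \<Rightarrow> real^'m \<Rightarrow> real" where
  "christoffel G k i j y =
     (1/2) * (\<Sum>l\<in>UNIV. matrix_inv (G y) $ k $ l *
        (partial_deriv i (\<lambda>z. G z $ j $ l) y + partial_deriv j (\<lambda>z. G z $ i $ l) y
          - partial_deriv l (\<lambda>z. G z $ i $ j) y))"

text \<open>\<open>R(\<partial>\<^sub>i, \<partial>\<^sub>j) \<partial>\<^sub>k = \<Sum>l. curvature G l k i j * \<partial>\<^sub>l\<close>, where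
  \<open>R(X, Y) Z = \<nabla>\<^sub>X \<nabla>\<^sub>Y Z - \<nabla>\<^sub>Y \<nabla>\<^sub>X Z - \<nabla>\<^bsub>[X, Y]\<^esub> Z\<close>.\<close>

definition curvature ::
  "(real^'m \<Rightarrow> real^'m^'m) \<Rightarrow> 'm::finite \<Rightarrow> 'm \<Rightarrow> 'm \<Rightarrow> 'm \<Rightarrow> real^'m \<Rightarrow> real" where
  "curvature G l k i j y =
     partial_deriv i (christoffel G l j k) y - partial_deriv j (christoffel G l i k) y
     + (\<Sum>m\<in>UNIV. christoffel G l i m y * christoffel G m j k y
                  - christoffel G l j m y * christoffel G m i k y)"

text \<open>\<open>Ric(Y, Z)\<close> is the trace of \<open>X \<mapsto> R(X, Y) Z\<close>, so that the unit sphere has positive Ricci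
  curvature.\<close>

definition ricci ::
  "(real^'m \<Rightarrow> real^'m^'m) \<Rightarrow> 'm::finite \<Rightarrow> 'm \<Rightarrow> real^'m \<Rightarrow> real" where
  "ricci G j k y = (\<Sum>i\<in>UNIV. curvature G i k i j y)"

text \<open>\<open>Ric = \<mu> g\<close>; to be applied to Riemannian manifolds.\<close>

definition einstein :: "('p, 'c, 'm::finite) riemannian \<Rightarrow> real \<Rightarrow> bool" where
  "einstein M \<mu> \<longleftrightarrow>
     (\<forall>c\<in>charts M. \<forall>y\<in>cimage M c. \<forall>i j.
        ricci (local_metric M c) i j y = \<mu> * local_metric M c y $ i $ j)"


section \<open>Warped products and hyperbolic space\<close>

text \<open>The index type \<open>'n + 'd\<close> lists the coordinates of the base followed by those of the fibre.\<close>

definition warped_product ::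
  "('b, 'k, 'n::finite) riemannian \<Rightarrow> ('b \<Rightarrow> real) \<Rightarrow> ('p, 'c, 'd::finite) riemannian
     \<Rightarrow> ('b \<times> 'p, 'k \<times> 'c, 'n + 'd) riemannian" where
  "warped_product B f F =
     \<lparr> mspace = prod_topology (mspace B) (mspace F),
       charts = charts B \<times> charts F,
       cdom = (\<lambda>(k, c). cdom B k \<times> cdom F c),
       coord = (\<lambda>(k, c) (q, p). \<chi> i. case i of
          Inl a \<Rightarrow> coord B k q $ a
        | Inr b \<Rightarrow> coord F c p $ b),
       metric = (\<lambda>(k, c) (q, p). \<chi> i j. case (i, j) of
          (Inl a, Inl a') \<Rightarrow> metric B k q $ a $ a'
        | (Inr b, Inr b') \<Rightarrow> (f q)\<^sup>2 * metric F c p $ b $ b'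
        | _ \<Rightarrow> 0) \<rparr>"

text \<open>The index type of the coordinates carries no order; the parameter \<open>N\<close> is the index of the
  last coordinate \<open>x\<^sub>n\<close>, and the indices \<open>1, ..., n - 1\<close> are the elements of \<open>UNIV - {N}\<close>.\<close>

definition upper_half_space :: "'n::finite \<Rightarrow> (real^'n) set" where
  "upper_half_space N = {x. x $ N > 0}"

definition hyperbolic_space :: "'n::finite \<Rightarrow> (real^'n, unit, 'n) riemannian" where
  "hyperbolic_space N =
     \<lparr> mspace = top_of_set (upper_half_space N),
       charts = {()},
       cdom = (\<lambda>_. upper_half_space N),
       coord = (\<lambda>_ x. x),
       metric = (\<lambda>_ x. \<chi> i j. (if i = j then 1 else 0) / (x $ N)\<^sup>2) \<rparr>"

end

theory Submission
  imports Defs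
begin

text \<open>
  The Ricci curvature of the warped product splits into blocks, so that it is Einstein with constant
  \<open>\<lambda>\<close> iff \<open>Hess f = k f g\<close> on the base, where \<open>k = -(\<lambda> + n - 1) / d\<close>, and
  \<open>\<lambda>\<^sub>F = \<lambda> f\<^sup>2 + f \<Delta>f + (d - 1) |\<nabla>f|\<^sup>2\<close>.  In terms of \<open>u = x\<^sub>n f\<close> the first equation says that the
  Euclidean Hessian of \<open>u\<close> is \<open>w\<close> times the identity matrix, where \<open>w = \<partial>\<^sub>n f + k f / x\<^sub>n\<close>.  Hence
  \<open>\<partial>\<^sub>c u\<close> and so \<open>w\<close> depend on the coordinate \<open>x\<^sub>c\<close> only, for every \<open>c\<close>; as there is more than one
  coordinate, \<open>w\<close> is a constant \<open>A\<close> and \<open>u\<close> is a quadratic polynomial.  Comparing \<open>\<partial>\<^sub>n u\<close> with \<open>w\<close>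
  gives \<open>(1 - k) f = \<beta>\<^sub>n\<close> for the linear coefficient \<open>\<beta>\<^sub>n\<close> of \<open>x\<^sub>n\<close>: either \<open>f\<close> is constant, which
  forces \<open>\<lambda>\<^sub>F < 0\<close>, or \<open>k = 1\<close> and \<open>\<beta>\<^sub>n = 0\<close>.
\<close>

section \<open>Partial derivatives\<close>

lemma partial_deriv_eq:
  assumes "(h has_derivative h') (at y)"
  shows "partial_deriv i h y = h' (axis i 1)"
  using frechet_derivative_at[OF assms] by (simp add: partial_deriv_def)

text \<open>\<open>frechet_derivative\<close> is a choice among the derivatives of a function at a
  point, so it suffices that both functions have the same derivatives at \<open>y\<close>. The
  equality thus covers points where neither is differentiable.\<close>

lemma partial_deriv_transform_open:
  assumes "open S" "y \<in> S" "\<And>z. z \<in> S \<Longrightarrow> h z = h' z"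
  shows "partial_deriv i h y = partial_deriv i h' y"
proof -
  have "(h has_derivative D) (at y) \<longleftrightarrow> (h' has_derivative D) (at y)" for D
    using has_derivative_transform_within_open[OF _ assms(1,2), of h D UNIV h']
      has_derivative_transform_within_open[OF _ assms(1,2), of h' D UNIV h] assms(3) by auto
  then show ?thesis
    by (simp add: partial_deriv_def frechet_derivative_def)
qed

lemma partial_deriv_const [simp]: "partial_deriv i (\<lambda>z. c) y = 0"
  by (subst partial_deriv_eq[OF has_derivative_const]) simp

lemma differentiable_nth [simp]: "(\<lambda>z. z $ j) differentiable at y"
  using bounded_linear_imp_differentiable bounded_linear_vec_nth by blast

lemma partial_deriv_nth: "partial_deriv i (\<lambda>z. z $ j) y = of_bool (i = j)"
  by (subst partial_deriv_eq[OF bounded_linear_imp_has_derivative[OF bounded_linear_vec_nth]])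
     (simp add: axis_def)

lemma partial_deriv_add:
  assumes "h differentiable at y" "k differentiable at y"
  shows "partial_deriv i (\<lambda>z. h z + k z) y = partial_deriv i h y + partial_deriv i k y"
  by (subst partial_deriv_eq[OF has_derivative_add])
     (use assms in \<open>auto simp: partial_deriv_def frechet_derivative_works\<close>)

lemma partial_deriv_diff:
  assumes "h differentiable at y" "k differentiable at y"
  shows "partial_deriv i (\<lambda>z. h z - k z) y = partial_deriv i h y - partial_deriv i k y"
  by (subst partial_deriv_eq[OF has_derivative_diff])
     (use assms in \<open>auto simp: partial_deriv_def frechet_derivative_works\<close>)

lemma partial_deriv_mult:
  assumes "h differentiable at y" "k differentiable at y"
  shows "partial_deriv i (\<lambda>z. h z * k z) y = h y * partial_deriv i k y + partial_deriv i h y * k y"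
  by (subst partial_deriv_eq[OF has_derivative_mult])
     (use assms in \<open>auto simp: partial_deriv_def frechet_derivative_works\<close>)

lemma partial_deriv_sum:
  assumes "finite I" "\<And>j. j \<in> I \<Longrightarrow> \<phi> j differentiable at x"
  shows "partial_deriv i (\<lambda>z. \<Sum>j\<in>I. \<phi> j z) x = (\<Sum>j\<in>I. partial_deriv i (\<phi> j) x)"
  using assms by (induction I) (simp_all add: partial_deriv_add)

lemma partial_deriv_cmult:
  "h differentiable at x \<Longrightarrow> partial_deriv i (\<lambda>z. c * h z) x = c * partial_deriv i h x"
  by (simp add: partial_deriv_mult)

lemma partial_deriv_compose:
  fixes \<phi> :: "real \<Rightarrow> real"
  assumes "h differentiable at y" "(\<phi> has_real_derivative D) (at (h y))"
  shows "partial_deriv i (\<lambda>z. \<phi> (h z)) y = D * partial_deriv i h y"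
proof -
  have "(h has_derivative frechet_derivative h (at y)) (at y)"
    using assms(1) frechet_derivative_works by blast
  from has_derivative_compose[OF this, of \<phi> "(*) D"] assms(2)
  have "((\<lambda>z. \<phi> (h z)) has_derivative (\<lambda>v. D * frechet_derivative h (at y) v)) (at y)"
    by (simp add: has_field_derivative_def)
  from partial_deriv_eq[OF this] show ?thesis by (simp add: partial_deriv_def)
qed

lemma has_real_derivative_along_axis:
  assumes "h differentiable at y"
  shows "((\<lambda>t. h (y + t *\<^sub>R axis i 1)) has_real_derivative partial_deriv i h y) (at 0)"
proof -
  have h: "(h has_derivative frechet_derivative h (at y)) (at (y + 0 *\<^sub>R axis i 1))"
    using assms frechet_derivative_works by auto
  have "((\<lambda>t. y + t *\<^sub>R axis i 1) has_derivative (\<lambda>t. t *\<^sub>R axis i 1)) (at 0)"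
    by (auto intro!: derivative_eq_intros)
  from has_derivative_compose[OF this h]
  have "((\<lambda>t. h (y + t *\<^sub>R axis i 1)) has_derivative (\<lambda>t. frechet_derivative h (at y) (t *\<^sub>R axis i 1))) (at 0)" .
  moreover have "frechet_derivative h (at y) (t *\<^sub>R axis i 1) = partial_deriv i h y * t" for t
    using linear_frechet_derivative[OF assms] by (simp add: partial_deriv_def linear_cmul)
  ultimately show ?thesis by (simp add: has_field_derivative_def)
qed

lemma frechet_derivative_partial_deriv:
  assumes "h differentiable at y"
  shows "frechet_derivative h (at y) v = (\<Sum>i\<in>UNIV. v $ i * partial_deriv i h y)"
proof -
  have lin: "linear (frechet_derivative h (at y))"
    by (rule linear_frechet_derivative[OF assms])
  have "frechet_derivative h (at y) v = frechet_derivative h (at y) (\<Sum>i\<in>UNIV. v $ i *s axis i 1)"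
    by (simp add: basis_expansion)
  also have "\<dots> = (\<Sum>i\<in>UNIV. v $ i * partial_deriv i h y)"
    by (simp add: linear_sum[OF lin] scalar_mult_eq_scaleR linear_cmul[OF lin] partial_deriv_def)
  finally show ?thesis .
qed

text \<open>Along the segment from \<open>x\<close> to \<open>y\<close> the derivative of
  \<open>h\<close> is a sum of terms \<open>(y - x) $ i * partial_deriv i h\<close>. Each one
  vanishes: the first factor if \<open>i\<close> is in \<open>J\<close>, the second one otherwise.
  With \<open>J\<close> empty this says that \<open>h\<close> is constant; with
  \<open>J = {c}\<close>, that \<open>h\<close> depends on one coordinate only.\<close>

lemma eq_if_partial_derivs_zero:
  assumes S: "open S" "convex S" and "\<And>z. z \<in> S \<Longrightarrow> h differentiable at z"
    and zero: "\<And>z i. z \<in> S \<Longrightarrow> i \<notin> J \<Longrightarrow> partial_deriv i h z = 0"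
    and xy: "x \<in> S" "y \<in> S" "\<And>i. i \<in> J \<Longrightarrow> x $ i = y $ i"
  shows "h x = h y"
proof -
  define \<gamma> where "\<gamma> t = x + t *\<^sub>R (y - x)" for t :: real
  have \<gamma>: "\<gamma> t \<in> S" if "0 \<le> t" "t \<le> 1" for t
    using convexD_alt[OF S(2) xy(1,2) that] by (simp add: \<gamma>_def algebra_simps)
  have d: "((\<lambda>t. h (\<gamma> t)) has_derivative (\<lambda>s. 0)) (at t)" if "0 \<le> t" "t \<le> 1" for t
  proof -
    have "(\<gamma> has_derivative (\<lambda>s. s *\<^sub>R (y - x))) (at t)"
      unfolding \<gamma>_def by (auto intro!: derivative_eq_intros)
    moreover have "(h has_derivative frechet_derivative h (at (\<gamma> t))) (at (\<gamma> t))"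
      using assms(3)[OF \<gamma>[OF that]] frechet_derivative_works by blast
    ultimately have "((\<lambda>t. h (\<gamma> t)) has_derivative (\<lambda>s. frechet_derivative h (at (\<gamma> t)) (s *\<^sub>R (y - x)))) (at t)"
      by (rule has_derivative_compose)
    moreover have "frechet_derivative h (at (\<gamma> t)) (s *\<^sub>R (y - x)) = 0" for s
    proof -
      have "(s *\<^sub>R (y - x)) $ i * partial_deriv i h (\<gamma> t) = 0" for i
        using zero[OF \<gamma>[OF that], of i] xy(3)[of i] by (cases "i \<in> J") auto
      then show ?thesis
        unfolding frechet_derivative_partial_deriv[OF assms(3)[OF \<gamma>[OF that]]] by (intro sum.neutral) blast
    qed
    ultimately show ?thesis by simp
  qed
  then have "continuous_on {0..1} (\<lambda>t. h (\<gamma> t))"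
    by (intro continuous_at_imp_continuous_on ballI has_derivative_continuous) auto
  moreover have "((\<lambda>t. h (\<gamma> t)) has_real_derivative 0) (at t)" if "0 < t" "t < 1" for t
    using d[of t] that by (simp add: has_field_derivative_def lambda_zero)
  ultimately have "h (\<gamma> 1) = h (\<gamma> 0)"
    using DERIV_isconst_end[of 0 1 "\<lambda>t. h (\<gamma> t)"] by simp
  then show ?thesis by (simp add: \<gamma>_def)
qed

section \<open>Smooth functions under differentiation and change off an open set\<close>

lemma smooth_on_differentiable:
  "smooth_on S h \<Longrightarrow> y \<in> S \<Longrightarrow> h differentiable at y"
  unfolding smooth_on_def by (metis Ck_on.simps(2))

lemma smooth_on_partial_deriv: "smooth_on S h \<Longrightarrow> smooth_on S (partial_deriv i h)"
  unfolding smooth_on_def by (metis Ck_on.simps(2))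

lemma Ck_on_cong:
  assumes "open S" "\<And>z. z \<in> S \<Longrightarrow> h z = h' z"
  shows "Ck_on k h S \<longleftrightarrow> Ck_on k h' S"
  using assms(2)
proof (induction k arbitrary: h h')
  case 0
  then show ?case by (simp cong: continuous_on_cong)
next
  case (Suc k)
  have "(\<forall>y\<in>S. h differentiable (at y)) \<longleftrightarrow> (\<forall>y\<in>S. h' differentiable (at y))"
    unfolding differentiable_def
    using Suc.prems has_derivative_transform_within_open[OF _ assms(1)] by metis
  moreover have "Ck_on k (partial_deriv i h) S \<longleftrightarrow> Ck_on k (partial_deriv i h') S" for i
    by (rule Suc.IH) (use Suc.prems partial_deriv_transform_open[OF assms(1)] in blast)
  ultimately show ?case by simp
qed

text \<open>Turns Kronecker deltas written with \<open>of_bool\<close> into conditionals, the form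
  in which the simplifier collapses a sum to a single term.\<close>

lemma of_bool_if_distribs:
  fixes a x :: real
  shows "of_bool P * x = (if P then x else 0)" "x * of_bool P = (if P then x else 0)"
    "a * (if P then x else 0) = (if P then a * x else 0)" "(if P then x else 0) * a = (if P then x * a else 0)"
    "(if P then x else 0) / a = (if P then x / a else 0)" "- (if P then x else 0) = (if P then - x else 0)"
  by auto

lemma sum_UNIV_sum:
  "(\<Sum>i\<in>UNIV. \<phi> (i :: 'a::finite + 'b::finite)) = (\<Sum>a\<in>UNIV. \<phi> (Inl a)) + (\<Sum>b\<in>UNIV. \<phi> (Inr b))"
  by (simp add: UNIV_Plus_UNIV[symmetric] sum.Plus del: UNIV_Plus_UNIV)

section \<open>Christoffel symbols\<close>

lemma matrix_inv_eq:
  fixes A :: "real^'m^'m"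
  assumes "A ** B = mat 1"
  shows "matrix_inv A = B"
proof -
  have BA: "B ** A = mat 1" using assms matrix_left_right_inverse by blast
  show ?thesis
    unfolding matrix_inv_def
  proof (rule some_equality)
    fix C assume "A ** C = mat 1 \<and> C ** A = mat 1"
    then show "C = B" by (metis BA matrix_mul_assoc matrix_mul_lid matrix_mul_rid)
  qed (use assms BA in blast)
qed

lemma matrix_inv_right:
  fixes A :: "real^'m^'m"
  assumes "invertible A"
  shows "A ** matrix_inv A = mat 1"
  using assms matrix_inv_eq by (metis invertible_def)

text \<open>Cramer's rule, applied to the \<open>l\<close>-th column of the inverse. It presents the
  entries of the inverse as quotients of determinants, hence as rational functions of the entries of
  \<open>A\<close>.\<close>

lemma matrix_inv_nth:
  fixes A :: "real^'m^'m"
  assumes "invertible A"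
  shows "matrix_inv A $ k $ l = det (\<chi> i j. if j = k then axis l 1 $ i else A $ i $ j) / det A"
proof -
  have "A *v (\<chi> i. matrix_inv A $ i $ l) = axis l 1"
  proof -
    have "A ** matrix_inv A = mat 1" using assms matrix_inv_right by blast
    then show ?thesis
      by (simp add: vec_eq_iff matrix_vector_mult_def matrix_matrix_mult_def mat_def axis_def eq_commute)
  qed
  then have "(\<chi> i. matrix_inv A $ i $ l) = (\<chi> k. det (\<chi> i j. if j = k then axis l 1 $ i else A $ i $ j) / det A)"
    using cramer assms invertible_det_nz by blast
  then show ?thesis by (simp add: vec_eq_iff)
qed

lemma differentiable_det:
  fixes A :: "real^'k \<Rightarrow> real^'m^'m"
  assumes "\<And>i j. (\<lambda>z. A z $ i $ j) differentiable at y"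
  shows "(\<lambda>z. det (A z)) differentiable at y"
proof -
  have "(\<lambda>z. \<Prod>i\<in>UNIV. A z $ i $ p i) differentiable at y" for p
    unfolding differentiable_def
    by (rule exI, rule has_derivative_prod) (use assms in \<open>auto simp: frechet_derivative_works\<close>)
  then show ?thesis
    unfolding det_def by (intro differentiable_sum differentiable_mult differentiable_const) auto
qed

text \<open>Cramer's formula holds on all of the open set \<open>S\<close>, where \<open>G\<close>
  is invertible, so its differentiability at \<open>y\<close> carries over to the inverse.\<close>

lemma differentiable_matrix_inv:
  fixes G :: "real^'k \<Rightarrow> real^'m^'m"
  assumes S: "open S" "y \<in> S" and "\<And>z. z \<in> S \<Longrightarrow> invertible (G z)"
    and "\<And>i j. (\<lambda>z. G z $ i $ j) differentiable at y"
  shows "(\<lambda>z. matrix_inv (G z) $ k $ l) differentiable at y"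
proof -
  have "(\<lambda>z. det (\<chi> i j. if j = k then axis l 1 $ i else G z $ i $ j)) differentiable at y"
  proof (rule differentiable_det)
    fix i j
    show "(\<lambda>z. (\<chi> i j. if j = k then axis l 1 $ i else G z $ i $ j) $ i $ j) differentiable at y"
      using assms(4) by (cases "j = k") simp_all
  qed
  moreover have "(\<lambda>z. det (G z)) differentiable at y"
    by (rule differentiable_det) (rule assms(4))
  moreover have "det (G y) \<noteq> 0" using assms by (simp add: invertible_det_nz[symmetric])
  ultimately have "(\<lambda>z. det (\<chi> i j. if j = k then axis l 1 $ i else G z $ i $ j) / det (G z)) differentiable at y"
    by (rule differentiable_divide)
  then obtain D where "((\<lambda>z. det (\<chi> i j. if j = k then axis l 1 $ i else G z $ i $ j) / det (G z)) has_derivative D) (at y)"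
    unfolding differentiable_def by blast
  then show ?thesis unfolding differentiable_def
    by (intro exI, rule has_derivative_transform_within_open[OF _ S]) (use assms(3) in \<open>simp_all add: matrix_inv_nth\<close>)
qed

lemma differentiable_christoffel:
  assumes S: "open S" "y \<in> S" and "\<And>z. z \<in> S \<Longrightarrow> invertible (G z)"
    and sm: "\<And>i j. smooth_on S (\<lambda>z. G z $ i $ j)"
  shows "christoffel G k i j differentiable at y"
proof -
  have d: "partial_deriv i (\<lambda>z. G z $ j $ l) differentiable at y" for i j l
    using smooth_on_differentiable[OF smooth_on_partial_deriv[OF sm] S(2)] .
  have m: "(\<lambda>z. matrix_inv (G z) $ k $ l) differentiable at y" for l
    by (rule differentiable_matrix_inv[OF S assms(3) smooth_on_differentiable[OF sm S(2)]])
  have "(\<lambda>y. christoffel G k i j y) differentiable at y"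
    unfolding christoffel_def
    by (intro differentiable_mult differentiable_sum differentiable_add differentiable_diff
        differentiable_const finite d m ballI)
  then show ?thesis by simp
qed

text \<open>The Levi-Civita connection has no torsion: with a symmetric metric, exchanging
  \<open>i\<close> and \<open>j\<close> only permutes the three derivative terms.\<close>

lemma christoffel_commute:
  assumes S: "open S" "y \<in> S" and "\<And>z. z \<in> S \<Longrightarrow> transpose (G z) = G z"
  shows "christoffel G k i j y = christoffel G k j i y"
proof -
  have "G z $ i $ j = G z $ j $ i" if "z \<in> S" for z
    using assms(3)[OF that] by (simp add: transpose_def vec_eq_iff)
  then have "partial_deriv l (\<lambda>z. G z $ i $ j) y = partial_deriv l (\<lambda>z. G z $ j $ i) y" for l
    using partial_deriv_transform_open[OF S] by meson
  then show ?thesis by (simp add: christoffel_def add.commute)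
qed

lemma christoffel_transform_open:
  assumes "open S" "y \<in> S" "\<And>z. z \<in> S \<Longrightarrow> G z = G' z"
  shows "christoffel G k i j y = christoffel G' k i j y"
proof -
  have "partial_deriv l (\<lambda>z. G z $ i $ j) y = partial_deriv l (\<lambda>z. G' z $ i $ j) y" for i j l
    using assms by (intro partial_deriv_transform_open) auto
  then show ?thesis using assms by (simp add: christoffel_def)
qed

lemma ricci_transform_open:
  assumes "open S" "y \<in> S" "\<And>z. z \<in> S \<Longrightarrow> G z = G' z"
  shows "ricci G j k y = ricci G' j k y"
proof -
  have c: "christoffel G k i j z = christoffel G' k i j z" if "z \<in> S" for i j k z
    using christoffel_transform_open assms that by blast
  have "partial_deriv l (christoffel G k i j) y = partial_deriv l (christoffel G' k i j) y" for l i j k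
    using assms c by (intro partial_deriv_transform_open)
  then show ?thesis using assms(2) by (simp add: ricci_def curvature_def c)
qed

section \<open>Ricci curvature of a warped product\<close>

definition base_part :: "real^('n::finite + 'd::finite) \<Rightarrow> real^'n" where
  "base_part y = (\<chi> a. y $ Inl a)"

definition fibre_part :: "real^('n::finite + 'd::finite) \<Rightarrow> real^'d" where
  "fibre_part y = (\<chi> b. y $ Inr b)"

lemma bounded_linear_base_part: "bounded_linear base_part"
  by (simp add: linear_conv_bounded_linear[symmetric] linear_iff base_part_def vec_eq_iff)

lemma bounded_linear_fibre_part: "bounded_linear fibre_part"
  by (simp add: linear_conv_bounded_linear[symmetric] linear_iff fibre_part_def vec_eq_iff)

lemma base_part_axis [simp]:
  "base_part (axis (Inl a) 1) = axis a 1" "base_part (axis (Inr b) 1) = 0"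
  by (auto simp: base_part_def axis_def vec_eq_iff)

lemma fibre_part_axis [simp]:
  "fibre_part (axis (Inl a) 1) = 0" "fibre_part (axis (Inr b) 1) = axis b 1"
  by (auto simp: fibre_part_def axis_def vec_eq_iff)

lemma open_base_fibre:
  assumes "open B" "open S"
  shows "open {y. base_part y \<in> B \<and> fibre_part y \<in> S}"
proof -
  have "open (base_part -` B \<inter> fibre_part -` S)"
    using assms bounded_linear_base_part bounded_linear_fibre_part
    by (intro open_Int open_vimage linear_continuous_on)
  then show ?thesis by (simp add: vimage_def Int_def)
qed

text \<open>The nonzero metric components and Christoffel symbols of a warped product are all a
  function of the base times a function of the fibre; the product rule then loses one of its two
  terms. The cases with a factor 1 follow below.\<close>

lemma partial_deriv_base_fibre:
  assumes p: "p differentiable at (base_part y)" and q: "q differentiable at (fibre_part y)"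
  shows "partial_deriv (Inl a) (\<lambda>z. p (base_part z) * q (fibre_part z)) y
      = partial_deriv a p (base_part y) * q (fibre_part y)"
    and "partial_deriv (Inr b) (\<lambda>z. p (base_part z) * q (fibre_part z)) y
      = p (base_part y) * partial_deriv b q (fibre_part y)"
proof -
  let ?P = "frechet_derivative p (at (base_part y))" and ?Q = "frechet_derivative q (at (fibre_part y))"
  have P: "((\<lambda>z. p (base_part z)) has_derivative (\<lambda>v. ?P (base_part v))) (at y)"
    using has_derivative_compose[OF bounded_linear_imp_has_derivative[OF bounded_linear_base_part]]
      p frechet_derivative_works by blast
  have Q: "((\<lambda>z. q (fibre_part z)) has_derivative (\<lambda>v. ?Q (fibre_part v))) (at y)"
    using has_derivative_compose[OF bounded_linear_imp_has_derivative[OF bounded_linear_fibre_part]]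
      q frechet_derivative_works by blast
  have "?P 0 = 0" "?Q 0 = 0"
    using linear_frechet_derivative p q linear_0 by blast+
  then show "partial_deriv (Inl a) (\<lambda>z. p (base_part z) * q (fibre_part z)) y
      = partial_deriv a p (base_part y) * q (fibre_part y)"
    and "partial_deriv (Inr b) (\<lambda>z. p (base_part z) * q (fibre_part z)) y
      = p (base_part y) * partial_deriv b q (fibre_part y)"
    by (simp_all add: partial_deriv_eq[OF has_derivative_mult[OF P Q]]) (simp_all add: partial_deriv_def)
qed

lemmas partial_deriv_base = partial_deriv_base_fibre[where q = "\<lambda>_. 1", simplified]
lemmas partial_deriv_fibre = partial_deriv_base_fibre[where p = "\<lambda>_. 1", simplified]

text \<open>Contravariant components: the differential of \<open>f\<close> with its index raised by
  the metric \<open>h\<close>.\<close>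

definition gradient :: "(real^'n \<Rightarrow> real^'n^'n) \<Rightarrow> (real^'n \<Rightarrow> real) \<Rightarrow> 'n::finite \<Rightarrow> real^'n \<Rightarrow> real" where
  "gradient h f a x = (\<Sum>e\<in>UNIV. matrix_inv (h x) $ a $ e * partial_deriv e f x)"

definition hessian :: "(real^'n \<Rightarrow> real^'n^'n) \<Rightarrow> (real^'n \<Rightarrow> real) \<Rightarrow> 'n::finite \<Rightarrow> 'n \<Rightarrow> real^'n \<Rightarrow> real" where
  "hessian h f b c x = partial_deriv b (partial_deriv c f) x
     - (\<Sum>e\<in>UNIV. christoffel h e b c x * partial_deriv e f x)"

definition warped_metric ::
  "(real^'n \<Rightarrow> real^'n^'n) \<Rightarrow> (real^'n \<Rightarrow> real) \<Rightarrow> (real^'d \<Rightarrow> real^'d^'d)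
    \<Rightarrow> real^('n::finite + 'd::finite) \<Rightarrow> real^('n + 'd)^('n + 'd)" where
  "warped_metric h f g y = (\<chi> i j. case (i, j) of
          (Inl a, Inl a') \<Rightarrow> h (base_part y) $ a $ a'
        | (Inr b, Inr b') \<Rightarrow> (f (base_part y))\<^sup>2 * g (fibre_part y) $ b $ b'
        | _ \<Rightarrow> 0)"

text \<open>Ricci curvature is local, so the computation takes place in a single product chart, with
  both metrics given as matrix-valued functions on open sets of Euclidean space.\<close>

locale warped_chart =
  fixes h :: "real^'n \<Rightarrow> real^'n^'n" and g :: "real^'d \<Rightarrow> real^'d^'d"
    and f :: "real^'n::finite \<Rightarrow> real" and B :: "(real^'n) set" and S :: "(real^'d::finite) set"
  assumes open_B: "open B" and open_S: "open S"
    and smooth_h: "\<And>a b. smooth_on B (\<lambda>x. h x $ a $ b)"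
    and smooth_g: "\<And>a b. smooth_on S (\<lambda>z. g z $ a $ b)"
    and smooth_f: "smooth_on B f"
    and f_nonzero: "\<And>x. x \<in> B \<Longrightarrow> f x \<noteq> 0"
    and inv_h: "\<And>x. x \<in> B \<Longrightarrow> invertible (h x)"
    and inv_g: "\<And>z. z \<in> S \<Longrightarrow> invertible (g z)"
    and sym_g: "\<And>z. z \<in> S \<Longrightarrow> transpose (g z) = g z"
begin

abbreviation W :: "real^('n + 'd) \<Rightarrow> real^('n + 'd)^('n + 'd)" where
  "W \<equiv> warped_metric h f g"

definition U :: "(real^('n + 'd)) set" where
  "U = {y. base_part y \<in> B \<and> fibre_part y \<in> S}"

lemma open_U: "open U"
  unfolding U_def by (rule open_base_fibre[OF open_B open_S])

lemma U_D: "y \<in> U \<Longrightarrow> base_part y \<in> B" "y \<in> U \<Longrightarrow> fibre_part y \<in> S"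
  by (auto simp: U_def)

lemma W_nth [simp]:
  "W y $ Inl a $ Inl a' = h (base_part y) $ a $ a'"
  "W y $ Inr b $ Inr b' = (f (base_part y))\<^sup>2 * g (fibre_part y) $ b $ b'"
  "W y $ Inl a $ Inr b = 0" "W y $ Inr b $ Inl a = 0"
  by (simp_all add: warped_metric_def)

lemma matrix_inv_W:
  assumes y: "y \<in> U"
  shows "matrix_inv (W y) $ Inl a $ Inl a' = matrix_inv (h (base_part y)) $ a $ a'"
    and "matrix_inv (W y) $ Inr b $ Inr b' = matrix_inv (g (fibre_part y)) $ b $ b' / (f (base_part y))\<^sup>2"
    and "matrix_inv (W y) $ Inl a $ Inr b = 0" "matrix_inv (W y) $ Inr b $ Inl a = 0"
proof -
  let ?V = "\<chi> i j. case (i, j) of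
          (Inl a, Inl a') \<Rightarrow> matrix_inv (h (base_part y)) $ a $ a'
        | (Inr b, Inr b') \<Rightarrow> matrix_inv (g (fibre_part y)) $ b $ b' / (f (base_part y))\<^sup>2
        | _ \<Rightarrow> 0"
  have "h (base_part y) ** matrix_inv (h (base_part y)) = mat 1"
    "g (fibre_part y) ** matrix_inv (g (fibre_part y)) = mat 1"
    using inv_h inv_g U_D[OF y] matrix_inv_right by auto
  then have "(\<Sum>e\<in>UNIV. h (base_part y) $ a $ e * matrix_inv (h (base_part y)) $ e $ b) = of_bool (a = b)"
    "(\<Sum>e\<in>UNIV. g (fibre_part y) $ c $ e * matrix_inv (g (fibre_part y)) $ e $ d) = of_bool (c = d)" for a b c d
    by (auto simp: vec_eq_iff matrix_matrix_mult_def mat_def)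
  then have "(W y ** ?V) $ i $ j = mat 1 $ i $ j" for i j
    using f_nonzero[OF U_D(1)[OF y]]
    by (cases i; cases j) (auto simp: matrix_matrix_mult_def mat_def sum_UNIV_sum)
  then have "W y ** ?V = mat 1" by (simp add: vec_eq_iff)
  then have "matrix_inv (W y) = ?V" by (rule matrix_inv_eq)
  then show "matrix_inv (W y) $ Inl a $ Inl a' = matrix_inv (h (base_part y)) $ a $ a'"
    and "matrix_inv (W y) $ Inr b $ Inr b' = matrix_inv (g (fibre_part y)) $ b $ b' / (f (base_part y))\<^sup>2"
    and "matrix_inv (W y) $ Inl a $ Inr b = 0" "matrix_inv (W y) $ Inr b $ Inl a = 0"
    by simp_all
qed

lemma partial_deriv_W:
  assumes y: "y \<in> U"
  shows "partial_deriv (Inl e) (\<lambda>z. h (base_part z) $ a $ a') y = partial_deriv e (\<lambda>x. h x $ a $ a') (base_part y)"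
    "partial_deriv (Inr c) (\<lambda>z. h (base_part z) $ a $ a') y = 0"
    "partial_deriv (Inl e) (\<lambda>z. (f (base_part z))\<^sup>2 * g (fibre_part z) $ b $ b') y
       = 2 * f (base_part y) * partial_deriv e f (base_part y) * g (fibre_part y) $ b $ b'"
    "partial_deriv (Inr c) (\<lambda>z. (f (base_part z))\<^sup>2 * g (fibre_part z) $ b $ b') y
       = (f (base_part y))\<^sup>2 * partial_deriv c (\<lambda>z. g z $ b $ b') (fibre_part y)"
proof -
  note d = smooth_on_differentiable[OF smooth_f U_D(1)[OF y]]
  have f2: "(\<lambda>x. (f x)\<^sup>2) differentiable at (base_part y)" using d by simp
  have "partial_deriv e (\<lambda>x. (f x)\<^sup>2) (base_part y) = 2 * f (base_part y) * partial_deriv e f (base_part y)"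
    using partial_deriv_mult[OF d d] by (simp add: power2_eq_square)
  then show "partial_deriv (Inl e) (\<lambda>z. h (base_part z) $ a $ a') y = partial_deriv e (\<lambda>x. h x $ a $ a') (base_part y)"
    "partial_deriv (Inr c) (\<lambda>z. h (base_part z) $ a $ a') y = 0"
    "partial_deriv (Inl e) (\<lambda>z. (f (base_part z))\<^sup>2 * g (fibre_part z) $ b $ b') y
       = 2 * f (base_part y) * partial_deriv e f (base_part y) * g (fibre_part y) $ b $ b'"
    "partial_deriv (Inr c) (\<lambda>z. (f (base_part z))\<^sup>2 * g (fibre_part z) $ b $ b') y
       = (f (base_part y))\<^sup>2 * partial_deriv c (\<lambda>z. g z $ b $ b') (fibre_part y)"
    using partial_deriv_base[OF smooth_on_differentiable[OF smooth_h U_D(1)[OF y]]]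
      partial_deriv_base_fibre[OF f2 smooth_on_differentiable[OF smooth_g U_D(2)[OF y]]]
    by auto
qed

text \<open>As \<open>W\<close> and its inverse are block diagonal, base and fibre interact only
  through the base derivatives of the factor \<open>f\<^sup>2\<close>. These yield
  \<open>- f * gradient f\<close> times \<open>g\<close> for two lower fibre indices, and the
  logarithmic derivative of \<open>f\<close> for one base and two equal fibre indices.\<close>

lemma christoffel_W:
  assumes y: "y \<in> U"
  shows "christoffel W (Inl a) (Inl b) (Inl c) y = christoffel h a b c (base_part y)"
    "christoffel W (Inl a) (Inl b) (Inr \<gamma>) y = 0"
    "christoffel W (Inl a) (Inr \<gamma>) (Inl b) y = 0"
    "christoffel W (Inl a) (Inr \<beta>) (Inr \<gamma>) y
       = - (f (base_part y) * gradient h f a (base_part y)) * g (fibre_part y) $ \<beta> $ \<gamma>"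
    "christoffel W (Inr \<alpha>) (Inl b) (Inl c) y = 0"
    "christoffel W (Inr \<alpha>) (Inl b) (Inr \<gamma>) y
       = (partial_deriv b f (base_part y) / f (base_part y)) * of_bool (\<alpha> = \<gamma>)"
    "christoffel W (Inr \<alpha>) (Inr \<gamma>) (Inl b) y
       = (partial_deriv b f (base_part y) / f (base_part y)) * of_bool (\<alpha> = \<gamma>)"
    "christoffel W (Inr \<alpha>) (Inr \<beta>) (Inr \<gamma>) y = christoffel g \<alpha> \<beta> \<gamma> (fibre_part y)"
proof -
  note s = christoffel_def sum_UNIV_sum matrix_inv_W[OF y] partial_deriv_W[OF y]
  let ?x = "base_part y" and ?z = "fibre_part y"
  have fx: "f ?x \<noteq> 0" using f_nonzero U_D[OF y] by blast
  \<comment> \<open>The contracted index is the second one in both factors; symmetry of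
    \<open>g\<close> turns the sum into an entry of the product of the inverse with
    \<open>g\<close>.\<close>
  have gg: "(\<Sum>e\<in>UNIV. matrix_inv (g ?z) $ \<alpha> $ e * g ?z $ \<gamma> $ e) = of_bool (\<alpha> = \<gamma>)"
  proof -
    have "matrix_inv (g ?z) ** g ?z = mat 1"
      using matrix_inv_right inv_g U_D(2)[OF y] matrix_left_right_inverse by blast
    moreover have "g ?z $ \<gamma> $ e = g ?z $ e $ \<gamma>" for e
      using sym_g[OF U_D(2)[OF y]] by (simp add: transpose_def vec_eq_iff)
    ultimately show ?thesis by (auto simp: vec_eq_iff matrix_matrix_mult_def mat_def)
  qed
  show "christoffel W (Inl a) (Inl b) (Inl c) y = christoffel h a b c ?x"
    "christoffel W (Inl a) (Inl b) (Inr \<gamma>) y = 0"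
    "christoffel W (Inl a) (Inr \<gamma>) (Inl b) y = 0"
    "christoffel W (Inr \<alpha>) (Inl b) (Inl c) y = 0"
    by (simp_all add: s)
  show "christoffel W (Inl a) (Inr \<beta>) (Inr \<gamma>) y = - (f ?x * gradient h f a ?x) * g ?z $ \<beta> $ \<gamma>"
    by (simp add: s) (simp add: gradient_def sum_distrib_left sum_distrib_right sum_negf[symmetric] mult_ac)
  have k: "(1/2) * (\<Sum>e\<in>UNIV. matrix_inv (g ?z) $ \<alpha> $ e / (f ?x)\<^sup>2 * (2 * f ?x * partial_deriv b f ?x * g ?z $ \<gamma> $ e))
     = (partial_deriv b f ?x / f ?x) * of_bool (\<alpha> = \<gamma>)"
    unfolding gg[symmetric] sum_distrib_left using fx
    by (intro sum.cong) (simp_all add: field_simps power2_eq_square)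
  show "christoffel W (Inr \<alpha>) (Inl b) (Inr \<gamma>) y = (partial_deriv b f ?x / f ?x) * of_bool (\<alpha> = \<gamma>)"
    "christoffel W (Inr \<alpha>) (Inr \<gamma>) (Inl b) y = (partial_deriv b f ?x / f ?x) * of_bool (\<alpha> = \<gamma>)"
    using k by (simp_all add: s)
  show "christoffel W (Inr \<alpha>) (Inr \<beta>) (Inr \<gamma>) y = christoffel g \<alpha> \<beta> \<gamma> ?z"
    using fx by (simp add: s right_diff_distrib[symmetric] distrib_left[symmetric] mult.assoc[symmetric] del: mult.assoc)
qed

text \<open>The formulas for the Christoffel symbols hold throughout the open set \<open>U\<close>,
  so they may be differentiated there.\<close>

lemma partial_deriv_christoffel_W:
  assumes y: "y \<in> U"
  shows "partial_deriv (Inl e) (christoffel W (Inl a) (Inl b) (Inl c)) y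
       = partial_deriv e (christoffel h a b c) (base_part y)"
    "partial_deriv (Inr \<epsilon>) (christoffel W (Inl a) (Inl b) (Inl c)) y = 0"
    "partial_deriv i (christoffel W (Inl a) (Inl b) (Inr \<gamma>)) y = 0"
    "partial_deriv i (christoffel W (Inl a) (Inr \<gamma>) (Inl b)) y = 0"
    "partial_deriv (Inl e) (christoffel W (Inl a) (Inr \<beta>) (Inr \<gamma>)) y
       = - partial_deriv e (\<lambda>x. f x * gradient h f a x) (base_part y) * g (fibre_part y) $ \<beta> $ \<gamma>"
    "partial_deriv i (christoffel W (Inr \<alpha>) (Inl b) (Inl c)) y = 0"
    "partial_deriv (Inl e) (christoffel W (Inr \<alpha>) (Inl b) (Inr \<gamma>)) y
       = partial_deriv e (\<lambda>x. partial_deriv b f x / f x) (base_part y) * of_bool (\<alpha> = \<gamma>)"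
    "partial_deriv (Inr \<epsilon>) (christoffel W (Inr \<alpha>) (Inl b) (Inr \<gamma>)) y = 0"
    "partial_deriv (Inl e) (christoffel W (Inr \<alpha>) (Inr \<gamma>) (Inl b)) y
       = partial_deriv e (\<lambda>x. partial_deriv b f x / f x) (base_part y) * of_bool (\<alpha> = \<gamma>)"
    "partial_deriv (Inr \<epsilon>) (christoffel W (Inr \<alpha>) (Inr \<gamma>) (Inl b)) y = 0"
    "partial_deriv (Inl e) (christoffel W (Inr \<alpha>) (Inr \<beta>) (Inr \<gamma>)) y = 0"
    "partial_deriv (Inr \<epsilon>) (christoffel W (Inr \<alpha>) (Inr \<beta>) (Inr \<gamma>)) y
       = partial_deriv \<epsilon> (christoffel g \<alpha> \<beta> \<gamma>) (fibre_part y)"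
proof -
  let ?x = "base_part y" and ?z = "fibre_part y"
  have x: "?x \<in> B" and z: "?z \<in> S" using U_D[OF y] by auto
  have eq: "partial_deriv i (christoffel W k j l) y = partial_deriv i \<phi> y"
    if "\<And>w. w \<in> U \<Longrightarrow> christoffel W k j l w = \<phi> w" for i j k l \<phi>
    using partial_deriv_transform_open[OF open_U y that] .
  have dh: "christoffel h a b c differentiable at ?x" for a b c
    using differentiable_christoffel[OF open_B x inv_h smooth_h] .
  have dg: "christoffel g a b c differentiable at ?z" for a b c
    using differentiable_christoffel[OF open_S z inv_g smooth_g] .
  have f: "f differentiable at ?x" "\<And>b. partial_deriv b f differentiable at ?x"
    using smooth_f smooth_on_differentiable smooth_on_partial_deriv x by blast+
  have dgrad: "(\<lambda>x. - (f x * gradient h f a x)) differentiable at ?x" for a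
    unfolding gradient_def
    using differentiable_matrix_inv[OF open_B x inv_h smooth_on_differentiable[OF smooth_h x]]
    by (intro differentiable_mult differentiable_sum differentiable_minus f ballI finite) auto
  have df: "(\<lambda>x. partial_deriv b f x / f x) differentiable at ?x" for b
    using f f_nonzero[OF x] by (intro differentiable_divide)
  have dg': "(\<lambda>z. g z $ \<beta> $ \<gamma>) differentiable at ?z"
    using smooth_on_differentiable[OF smooth_g z] .
  have neg: "partial_deriv e (\<lambda>x. - (f x * gradient h f a x)) ?x = - partial_deriv e (\<lambda>x. f x * gradient h f a x) ?x"
  proof -
    have "(\<lambda>x. f x * gradient h f a x) differentiable at ?x"
      using differentiable_minus[OF dgrad] by simp
    from partial_deriv_mult[OF differentiable_const this, of e "-1"] show ?thesis by simp
  qed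
  show "partial_deriv (Inl e) (christoffel W (Inl a) (Inl b) (Inl c)) y = partial_deriv e (christoffel h a b c) ?x"
    "partial_deriv (Inr \<epsilon>) (christoffel W (Inl a) (Inl b) (Inl c)) y = 0"
    by (simp_all only: eq[OF christoffel_W(1)] partial_deriv_base[OF dh])
  show "partial_deriv i (christoffel W (Inl a) (Inl b) (Inr \<gamma>)) y = 0"
    "partial_deriv i (christoffel W (Inl a) (Inr \<gamma>) (Inl b)) y = 0"
    "partial_deriv i (christoffel W (Inr \<alpha>) (Inl b) (Inl c)) y = 0"
    by (simp_all only: eq[OF christoffel_W(2)] eq[OF christoffel_W(3)] eq[OF christoffel_W(5)] partial_deriv_const)
  show "partial_deriv (Inl e) (christoffel W (Inl a) (Inr \<beta>) (Inr \<gamma>)) y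
       = - partial_deriv e (\<lambda>x. f x * gradient h f a x) ?x * g ?z $ \<beta> $ \<gamma>"
    by (simp only: eq[OF christoffel_W(4)] partial_deriv_base_fibre[OF dgrad dg'] neg)
  show "partial_deriv (Inl e) (christoffel W (Inr \<alpha>) (Inl b) (Inr \<gamma>)) y
       = partial_deriv e (\<lambda>x. partial_deriv b f x / f x) ?x * of_bool (\<alpha> = \<gamma>)"
    "partial_deriv (Inr \<epsilon>) (christoffel W (Inr \<alpha>) (Inl b) (Inr \<gamma>)) y = 0"
    "partial_deriv (Inl e) (christoffel W (Inr \<alpha>) (Inr \<gamma>) (Inl b)) y
       = partial_deriv e (\<lambda>x. partial_deriv b f x / f x) ?x * of_bool (\<alpha> = \<gamma>)"
    "partial_deriv (Inr \<epsilon>) (christoffel W (Inr \<alpha>) (Inr \<gamma>) (Inl b)) y = 0"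
    by (simp_all only: eq[OF christoffel_W(6)] eq[OF christoffel_W(7)]
        partial_deriv_base_fibre[OF df differentiable_const] partial_deriv_const mult_zero_right)
  show "partial_deriv (Inl e) (christoffel W (Inr \<alpha>) (Inr \<beta>) (Inr \<gamma>)) y = 0"
    "partial_deriv (Inr \<epsilon>) (christoffel W (Inr \<alpha>) (Inr \<beta>) (Inr \<gamma>)) y
       = partial_deriv \<epsilon> (christoffel g \<alpha> \<beta> \<gamma>) ?z"
    by (simp_all only: eq[OF christoffel_W(8)] partial_deriv_fibre[OF dg])
qed

section \<open>The Ricci tensor of the warped metric, block by block\<close>

lemma partial_deriv_log_f:
  assumes x: "x \<in> B"
  shows "partial_deriv b (\<lambda>x. partial_deriv c f x / f x) x
    = partial_deriv b (partial_deriv c f) x / f x - partial_deriv b f x * partial_deriv c f x / (f x)\<^sup>2"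
proof -
  have f: "f differentiable at x" "\<And>b. partial_deriv b f differentiable at x"
    using smooth_f smooth_on_differentiable smooth_on_partial_deriv x by blast+
  have "partial_deriv b (\<lambda>x. inverse (f x)) x = - (inverse (f x) ^ 2) * partial_deriv b f x"
    using partial_deriv_compose[OF f(1) DERIV_inverse[OF f_nonzero[OF x]]] by (simp add: numeral_2_eq_2)
  then show ?thesis
    using partial_deriv_mult[OF f(2)[of c] differentiable_inverse[OF f(1) f_nonzero[OF x]], of b] f_nonzero[OF x]
    by (simp add: divide_inverse power_inverse algebra_simps)
qed

text \<open>In the trace, base directions give the Ricci curvature of \<open>h\<close>, and each of
  the \<open>CARD('d)\<close> fibre directions gives \<open>- hessian / f\<close>: the product of
  first derivatives that comes from differentiating \<open>partial_deriv c f / f\<close> cancels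
  against the quadratic Christoffel term.\<close>

lemma ricci_W_base:
  assumes y: "y \<in> U"
  shows "ricci W (Inl b) (Inl c) y
    = ricci h b c (base_part y) - real CARD('d) / f (base_part y) * hessian h f b c (base_part y)"
proof -
  let ?x = "base_part y"
  note s = christoffel_W[OF y] partial_deriv_christoffel_W[OF y]
  have fx: "f ?x \<noteq> 0" using f_nonzero U_D[OF y] by blast
  have "curvature W (Inl a) (Inl c) (Inl a) (Inl b) y = curvature h a c a b ?x" for a
    by (simp add: curvature_def sum_UNIV_sum s)
  moreover have "curvature W (Inr \<alpha>) (Inl c) (Inr \<alpha>) (Inl b) y = - (1 / f ?x) * hessian h f b c ?x" for \<alpha>
    using fx
    by (simp add: curvature_def sum_UNIV_sum s partial_deriv_log_f[OF U_D(1)[OF y]] hessian_def)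
       (simp add: sum_distrib_left sum_divide_distrib right_diff_distrib diff_divide_distrib power2_eq_square
          mult_ac of_bool_if_distribs if_distrib[of "\<lambda>t. _ / t"] cong: if_cong)
  ultimately show ?thesis
    by (simp add: ricci_def sum_UNIV_sum)
qed

text \<open>What survives is \<open>partial_deriv b f / f\<close> times a difference of contracted
  Christoffel symbols of \<open>g\<close>. These agree, for one of the two index orders only after
  the lower indices are exchanged.\<close>

lemma ricci_W_mixed:
  assumes y: "y \<in> U"
  shows "ricci W (Inl b) (Inr \<gamma>) y = 0" "ricci W (Inr \<gamma>) (Inl b) y = 0"
proof -
  note s = christoffel_W[OF y] partial_deriv_christoffel_W[OF y]
  have c: "christoffel g \<alpha> \<beta> \<gamma> (fibre_part y) = christoffel g \<alpha> \<gamma> \<beta> (fibre_part y)" for \<alpha> \<beta> \<gamma>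
    using christoffel_commute[OF open_S U_D(2)[OF y] sym_g] .
  show "ricci W (Inl b) (Inr \<gamma>) y = 0" "ricci W (Inr \<gamma>) (Inl b) y = 0"
    by (simp_all add: ricci_def curvature_def sum_UNIV_sum s sum_subtractf c[of _ \<gamma>] of_bool_if_distribs)
qed

text \<open>The sum over \<open>a\<close> in the second line is the divergence of \<open>f\<close>
  times its gradient, that is, \<open>f\<close> times the Laplacian plus the squared gradient norm.
  Together with the last summand, the bracket is \<open>f\<close> times the Laplacian plus
  \<open>d - 1\<close> times the squared norm.\<close>

lemma ricci_W_fibre:
  assumes y: "y \<in> U"
  shows "ricci W (Inr \<beta>) (Inr \<gamma>) y = ricci g \<beta> \<gamma> (fibre_part y) - g (fibre_part y) $ \<beta> $ \<gamma> *
    ((\<Sum>a\<in>UNIV. partial_deriv a (\<lambda>x. f x * gradient h f a x) (base_part y)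
        + (\<Sum>e\<in>UNIV. christoffel h a a e (base_part y) * (f (base_part y) * gradient h f e (base_part y))))
     + (real CARD('d) - 2) * (\<Sum>a\<in>UNIV. partial_deriv a f (base_part y) * gradient h f a (base_part y)))"
proof -
  let ?x = "base_part y" and ?z = "fibre_part y"
  let ?n = "\<Sum>a\<in>UNIV. partial_deriv a f ?x * gradient h f a ?x"
  note s = christoffel_W[OF y] partial_deriv_christoffel_W[OF y]
  have fx: "f ?x \<noteq> 0" using f_nonzero U_D[OF y] by blast
  have "curvature W (Inl a) (Inr \<gamma>) (Inl a) (Inr \<beta>) y = - g ?z $ \<beta> $ \<gamma> *
    (partial_deriv a (\<lambda>x. f x * gradient h f a x) ?x
        + (\<Sum>e\<in>UNIV. christoffel h a a e ?x * (f ?x * gradient h f e ?x))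
        - partial_deriv a f ?x * gradient h f a ?x)" for a
    using fx by (simp add: curvature_def sum_UNIV_sum s sum_negf sum_distrib_left algebra_simps)
  \<comment> \<open>One squared gradient norm is subtracted per fibre direction, and the delta gives
    one back. The base directions give back another, whence the factor \<open>d - 2\<close>.\<close>
  moreover have "curvature W (Inr \<alpha>) (Inr \<gamma>) (Inr \<alpha>) (Inr \<beta>) y = curvature g \<alpha> \<gamma> \<alpha> \<beta> ?z
    - g ?z $ \<beta> $ \<gamma> * ?n + of_bool (\<alpha> = \<beta>) * (g ?z $ \<alpha> $ \<gamma> * ?n)" for \<alpha>
    using fx by (auto simp add: curvature_def sum_UNIV_sum s sum_negf sum_distrib_left sum.distrib algebra_simps sum_subtractf)
  ultimately show ?thesis
    by (simp only: ricci_def sum_UNIV_sum sum.distrib sum_subtractf sum_distrib_left[symmetric])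
       (simp add: of_bool_if_distribs algebra_simps)
qed

end

section \<open>Hyperbolic space\<close>

definition hyperbolic_metric :: "'n::finite \<Rightarrow> real^'n \<Rightarrow> real^'n^'n" where
  "hyperbolic_metric N x = (\<chi> i j. (if i = j then 1 else 0) / (x $ N)\<^sup>2)"

lemma hyperbolic_metric_nth: "hyperbolic_metric N x $ i $ j = of_bool (i = j) / (x $ N)\<^sup>2"
  by (simp add: hyperbolic_metric_def)

lemma open_upper_half_space: "open (upper_half_space N)"
  unfolding upper_half_space_def by (simp add: open_Collect_less continuous_intros)

lemma convex_upper_half_space: "convex (upper_half_space N)"
  using convex_halfspace_gt[of 0 "axis N (1::real)"] by (simp add: upper_half_space_def inner_axis')

lemma differentiable_inverse_power:
  "x \<in> upper_half_space N \<Longrightarrow> (\<lambda>x. c * inverse (x $ N) ^ m) differentiable at x"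
  by (auto simp: upper_half_space_def intro!: differentiable_mult differentiable_power differentiable_inverse)

lemma partial_deriv_inverse_power:
  assumes "x \<in> upper_half_space N"
  shows "partial_deriv i (\<lambda>x. c * inverse (x $ N) ^ m) x = (- c * real m * of_bool (i = N)) * inverse (x $ N) ^ Suc m"
proof -
  have xN: "x $ N \<noteq> 0" using assms by (simp add: upper_half_space_def)
  have "((\<lambda>t. c * inverse t ^ m) has_real_derivative - c * real m * inverse (x $ N) ^ Suc m) (at (x $ N))"
  proof (cases m)
    case (Suc j)
    show ?thesis
      using DERIV_cmult[OF DERIV_power_Suc[OF DERIV_inverse[OF xN]], of c j] unfolding Suc
      by (simp add: numeral_2_eq_2 algebra_simps)
  qed simp
  from partial_deriv_compose[OF differentiable_nth this, of i] show ?thesis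
    by (simp add: partial_deriv_nth)
qed

text \<open>The family of functions \<open>c * inverse (x $ N) ^ m\<close> is closed under partial
  derivatives, so the induction on the order has to run over all \<open>c\<close> and
  \<open>m\<close> at once.\<close>

lemma smooth_on_inverse_power: "smooth_on (upper_half_space N) (\<lambda>x. c * inverse (x $ N) ^ m)"
proof -
  have "Ck_on k (\<lambda>x. c * inverse (x $ N) ^ m) (upper_half_space N)" for k
  proof (induction k arbitrary: c m)
    case 0
    show ?case using differentiable_inverse_power[of _ N c m]
      by (simp add: continuous_at_imp_continuous_on differentiable_imp_continuous_within)
  next
    case (Suc k)
    have "Ck_on k (partial_deriv i (\<lambda>x. c * inverse (x $ N) ^ m)) (upper_half_space N)" for i
      using Suc.IH by (subst Ck_on_cong[OF open_upper_half_space partial_deriv_inverse_power])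
    then show ?case using differentiable_inverse_power[of _ N c m] by (simp only: Ck_on.simps) blast
  qed
  then show ?thesis by (simp add: smooth_on_def)
qed

lemma hyperbolic_metric_inverse_power:
  "hyperbolic_metric N x $ i $ j = of_bool (i = j) * inverse (x $ N) ^ 2"
  by (simp add: hyperbolic_metric_nth divide_inverse power_inverse)

lemma smooth_on_hyperbolic_metric:
  "smooth_on (upper_half_space N) (\<lambda>x. hyperbolic_metric N x $ a $ b)"
  unfolding hyperbolic_metric_inverse_power by (rule smooth_on_inverse_power)

context
  fixes N :: "'n::finite" and x :: "real^'n"
  assumes x: "x \<in> upper_half_space N"
begin

lemma upper_half_space_nth_pos: "x $ N > 0" using x by (simp add: upper_half_space_def)

lemma hyperbolic_metric_right_inverse: "hyperbolic_metric N x ** (\<chi> a b. of_bool (a = b) * (x $ N)\<^sup>2) = mat 1"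
  using upper_half_space_nth_pos by (simp add: vec_eq_iff matrix_matrix_mult_def mat_def hyperbolic_metric_nth of_bool_if_distribs cong: if_cong)

lemma invertible_hyperbolic_metric: "invertible (hyperbolic_metric N x)"
  using hyperbolic_metric_right_inverse matrix_left_right_inverse by (metis invertible_def)

lemma matrix_inv_hyperbolic_metric: "matrix_inv (hyperbolic_metric N x) $ a $ b = of_bool (a = b) * (x $ N)\<^sup>2"
  using matrix_inv_eq[OF hyperbolic_metric_right_inverse] by simp

text \<open>The exponent 1 is kept so that \<open>partial_deriv_inverse_power\<close> applies to the
  symbols as they stand.\<close>

lemma christoffel_hyperbolic:
  "christoffel (hyperbolic_metric N) a b c x
    = (- of_bool (a = b) * of_bool (c = N) - of_bool (a = c) * of_bool (b = N) + of_bool (b = c) * of_bool (a = N)) * inverse (x $ N) ^ 1"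
proof -
  have pd: "partial_deriv e (\<lambda>z. hyperbolic_metric N z $ a $ b) x = (-2 * of_bool (a = b) * of_bool (e = N)) / (x $ N) ^ 3" for a b e
    unfolding hyperbolic_metric_inverse_power partial_deriv_inverse_power[OF x]
    by (simp add: divide_inverse power_inverse numeral_3_eq_3 numeral_2_eq_2)
  show ?thesis
    using upper_half_space_nth_pos unfolding christoffel_def matrix_inv_hyperbolic_metric pd
    by (simp add: of_bool_if_distribs cong: if_cong) (auto simp: field_simps power2_eq_square power3_eq_cube)
qed

end

text \<open>The Christoffel symbols are a constant array \<open>\<Gamma>\<close> divided by
  \<open>x $ N\<close>, and \<open>\<Gamma>\<close> is built from the Kronecker delta and the unit
  covector \<open>v\<close> of the last coordinate. Curvature thus reduces to contractions of
  \<open>\<delta>\<close> and \<open>v\<close>, over the square of \<open>x $ N\<close>.\<close>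

lemma ricci_hyperbolic:
  fixes N :: "'n::finite"
  assumes x: "x \<in> upper_half_space N"
  shows "ricci (hyperbolic_metric N) b c x = - (real CARD('n) - 1) * hyperbolic_metric N x $ b $ c"
proof -
  note xN = upper_half_space_nth_pos[OF x]
  define v :: "'n \<Rightarrow> real" where "v a = of_bool (a = N)" for a
  define \<delta> :: "'n \<Rightarrow> 'n \<Rightarrow> real" where "\<delta> a b = of_bool (a = b)" for a b
  define \<Gamma> where "\<Gamma> a b c = - \<delta> a b * v c - \<delta> a c * v b + \<delta> b c * v a" for a b c
  have \<delta>: "(\<Sum>m\<in>UNIV. \<delta> a m * u m) = u a" "(\<Sum>m\<in>UNIV. \<delta> m a * u m) = u a" "(\<Sum>m\<in>UNIV. v m * u m) = u N" for a u
    by (simp_all add: \<delta>_def v_def of_bool_if_distribs cong: if_cong)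
  have comm: "\<delta> a b = \<delta> b a" "\<delta> a a = 1" "\<delta> N a = v a" "v N = 1" for a b by (auto simp: \<delta>_def v_def)
  have chr: "christoffel (hyperbolic_metric N) a b c z = \<Gamma> a b c * inverse (z $ N) ^ 1"
    if "z \<in> upper_half_space N" for a b c z
    unfolding christoffel_hyperbolic[OF that] by (simp add: \<Gamma>_def \<delta>_def v_def)
  have pd: "partial_deriv e (christoffel (hyperbolic_metric N) a b c) x = - \<Gamma> a b c * v e / (x $ N)\<^sup>2" for a b c e
    by (subst partial_deriv_transform_open[OF open_upper_half_space x chr], assumption,
        subst partial_deriv_inverse_power[OF x]) (simp add: divide_inverse power2_eq_square v_def)
  have trace: "\<Gamma> a a c = - v c" for a c
    by (auto simp: \<Gamma>_def \<delta>_def)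
  define s where "s b c = \<delta> b c - 2 * v b * v c" for b c
  have vG: "(\<Sum>m\<in>UNIV. v m * \<Gamma> m b c) = s b c" for b c
    unfolding \<delta> by (simp add: \<Gamma>_def s_def comm(3,4))
  \<comment> \<open>Only the first factor is expanded: each of its terms contracts the second factor
    with \<open>v\<close> or with a delta, and those contractions are known.\<close>
  have GG: "(\<Sum>m\<in>UNIV. \<Gamma> a b m * \<Gamma> m a c) = - \<delta> a b * s a c + v b * v c + v a * \<Gamma> b a c" for a
  proof -
    have "(\<Sum>m\<in>UNIV. \<Gamma> a b m * \<Gamma> m a c)
      = (\<Sum>m\<in>UNIV. - \<delta> a b * (v m * \<Gamma> m a c) - v b * (\<delta> a m * \<Gamma> m a c) + v a * (\<delta> b m * \<Gamma> m a c))"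
      by (simp add: \<Gamma>_def[of a b] algebra_simps)
    then show ?thesis
      by (simp add: sum.distrib sum_subtractf sum_negf sum_distrib_left[symmetric] vG \<delta> trace)
  qed
  have "curvature (hyperbolic_metric N) a c a b x
    = (\<delta> b a * (2 * v c * v a + s a c) - 2 * v b * v c - s b c) / (x $ N)\<^sup>2" for a
  proof -
    have "(\<Sum>m\<in>UNIV. christoffel (hyperbolic_metric N) a a m x * christoffel (hyperbolic_metric N) m b c x
        - christoffel (hyperbolic_metric N) a b m x * christoffel (hyperbolic_metric N) m a c x)
      = (\<Sum>m\<in>UNIV. (- (v m * \<Gamma> m b c) - \<Gamma> a b m * \<Gamma> m a c) / (x $ N)\<^sup>2)"
      using xN by (intro sum.cong) (simp_all add: chr[OF x] trace field_simps power2_eq_square)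
    also have "\<dots> = ((\<Sum>m\<in>UNIV. - (v m * \<Gamma> m b c)) - (\<Sum>m\<in>UNIV. \<Gamma> a b m * \<Gamma> m a c)) / (x $ N)\<^sup>2"
      by (simp add: sum_divide_distrib[symmetric] sum_subtractf)
    finally have "curvature (hyperbolic_metric N) a c a b x = (- \<Gamma> a b c * v a + \<Gamma> a a c * v b
      + ((\<Sum>m\<in>UNIV. - (v m * \<Gamma> m b c)) - (\<Sum>m\<in>UNIV. \<Gamma> a b m * \<Gamma> m a c))) / (x $ N)\<^sup>2"
      by (simp add: curvature_def pd add_divide_distrib diff_divide_distrib)
    also have "\<dots> = (\<delta> b a * (2 * v c * v a + s a c) - 2 * v b * v c - s b c) / (x $ N)\<^sup>2"
      unfolding GG sum_negf vG trace using comm(1)[of a b]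
      by (simp add: \<Gamma>_def comm(1)[of a c] comm(1)[of b c] algebra_simps)
    finally show ?thesis .
  qed
  \<comment> \<open>Summing over \<open>a\<close> collapses the delta, and
    \<open>2 * v b * v c + s b c\<close> is \<open>\<delta> b c\<close>; the total is 1 minus the
    dimension times the delta.\<close>
  then have "ricci (hyperbolic_metric N) b c x
    = (2 * v c * v b + s b c - real CARD('n) * (2 * v b * v c + s b c)) / (x $ N)\<^sup>2"
    by (simp only: ricci_def sum_divide_distrib[symmetric] sum_subtractf \<delta>) (simp add: algebra_simps)
  also have "\<dots> = - (real CARD('n) - 1) * hyperbolic_metric N x $ b $ c"
    by (simp add: s_def hyperbolic_metric_nth \<delta>_def divide_simps algebra_simps)
  finally show ?thesis .
qed

lemma gradient_hyperbolic:
  "x \<in> upper_half_space N \<Longrightarrow> gradient (hyperbolic_metric N) f a x = (x $ N)\<^sup>2 * partial_deriv a f x"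
  by (simp add: gradient_def matrix_inv_hyperbolic_metric of_bool_if_distribs cong: if_cong)

lemma hessian_hyperbolic:
  assumes "x \<in> upper_half_space N"
  shows "hessian (hyperbolic_metric N) f b c x = partial_deriv b (partial_deriv c f) x
    + (of_bool (b = N) * partial_deriv c f x + of_bool (c = N) * partial_deriv b f x
       - of_bool (b = c) * partial_deriv N f x) / x $ N"
proof -
  have "(\<Sum>e\<in>UNIV. christoffel (hyperbolic_metric N) e b c x * partial_deriv e f x)
    = (\<Sum>e\<in>UNIV. (if e = N then of_bool (b = c) * partial_deriv e f x / x $ N else 0)
       - (if e = b then of_bool (c = N) * partial_deriv e f x / x $ N else 0)
       - (if e = c then of_bool (b = N) * partial_deriv e f x / x $ N else 0))"
    by (intro sum.cong) (auto simp: christoffel_hyperbolic[OF assms] divide_inverse)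
  then show ?thesis
    by (simp add: hessian_def sum_subtractf diff_divide_distrib add_divide_distrib)
qed

text \<open>The Leibniz rule for the divergence of \<open>f\<close> times its gradient. The factor
  \<open>(x $ N)\<^sup>2\<close> is the inverse metric, which turns Euclidean sums into the squared
  gradient norm and the Laplacian.\<close>

lemma divergence_hyperbolic:
  fixes N :: "'n::finite"
  assumes x: "x \<in> upper_half_space N" and f: "smooth_on (upper_half_space N) f"
  shows "(\<Sum>a\<in>UNIV. partial_deriv a (\<lambda>x. f x * gradient (hyperbolic_metric N) f a x) x
        + (\<Sum>e\<in>UNIV. christoffel (hyperbolic_metric N) a a e x * (f x * gradient (hyperbolic_metric N) f e x)))
    = (x $ N)\<^sup>2 * ((\<Sum>a\<in>UNIV. (partial_deriv a f x)\<^sup>2) + f x * (\<Sum>a\<in>UNIV. hessian (hyperbolic_metric N) f a a x))"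
proof -
  note xN = upper_half_space_nth_pos[OF x]
  have fd: "f differentiable at x" "\<And>b. partial_deriv b f differentiable at x"
    using f smooth_on_differentiable smooth_on_partial_deriv x by blast+
  have x2: "partial_deriv a (\<lambda>x. (x $ N)\<^sup>2) x = 2 * x $ N * of_bool (a = N)" for a
    using partial_deriv_mult[OF differentiable_nth differentiable_nth, of a N N x]
    by (simp add: power2_eq_square partial_deriv_nth)
  have 1: "partial_deriv a (\<lambda>x. f x * gradient (hyperbolic_metric N) f a x) x
     = f x * (x $ N)\<^sup>2 * partial_deriv a (partial_deriv a f) x + (x $ N)\<^sup>2 * (partial_deriv a f x)\<^sup>2
       + of_bool (a = N) * (2 * x $ N * f x * partial_deriv a f x)" for a
  proof -
    have "partial_deriv a (\<lambda>x. f x * gradient (hyperbolic_metric N) f a x) x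
      = partial_deriv a (\<lambda>x. f x * ((x $ N)\<^sup>2 * partial_deriv a f x)) x"
      by (rule partial_deriv_transform_open[OF open_upper_half_space x]) (simp add: gradient_hyperbolic)
    also have "\<dots> = f x * ((x $ N)\<^sup>2 * partial_deriv a (partial_deriv a f) x + 2 * x $ N * of_bool (a = N) * partial_deriv a f x)
        + partial_deriv a f x * ((x $ N)\<^sup>2 * partial_deriv a f x)"
      using fd by (simp add: partial_deriv_mult x2)
    finally show ?thesis by (simp add: algebra_simps power2_eq_square)
  qed
  have 2: "(\<Sum>e\<in>UNIV. christoffel (hyperbolic_metric N) a a e x * (f x * gradient (hyperbolic_metric N) f e x))
     = - (x $ N * f x * partial_deriv N f x)" for a
  proof -
    have "(\<Sum>e\<in>UNIV. christoffel (hyperbolic_metric N) a a e x * (f x * gradient (hyperbolic_metric N) f e x))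
       = (\<Sum>e\<in>UNIV. if e = N then - (x $ N * f x * partial_deriv N f x) else 0)"
      using xN by (intro sum.cong) (auto simp: christoffel_hyperbolic[OF x] gradient_hyperbolic[OF x] power2_eq_square)
    then show ?thesis by simp
  qed
  have 3: "(\<Sum>a\<in>UNIV. of_bool (a = N) * v a) = v N" for v :: "'n \<Rightarrow> real"
    by (simp add: of_bool_if_distribs cong: if_cong)
  show ?thesis
    unfolding 1 2 hessian_hyperbolic[OF x] sum.distrib 3 sum_subtractf sum_divide_distrib[symmetric]
    using xN by (simp add: sum_distrib_left 3 field_simps power2_eq_square)
qed

section \<open>From a single chart to the warped product manifold\<close>

lemma homeomorphic_map_inj_on:
  "homeomorphic_map (subtopology X S) Y \<phi> \<Longrightarrow> S \<subseteq> topspace X \<Longrightarrow> inj_on \<phi> S"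
  by (metis homeomorphic_imp_injective_map topspace_subtopology_subset)

lemma riemannian_coord_inj_on:
  assumes "riemannian_manifold F" "c \<in> charts F"
  shows "inj_on (coord F c) (cdom F c)"
  using assms unfolding riemannian_manifold_def smooth_manifold_def
  by (metis homeomorphic_map_inj_on openin_subset)

lemma pos_def_invertible:
  fixes A :: "real^'m^'m"
  assumes "\<And>v. v \<noteq> 0 \<Longrightarrow> v \<bullet> (A *v v) > 0"
  shows "invertible A"
  using assms matrix_left_invertible_ker by (metis inner_zero_right invertible_left_inverse less_irrefl)

text \<open>\<open>cinv\<close> is defined by \<open>inv_into\<close>, so the product chart must be
  shown injective before the preimage of \<open>y\<close> can be identified with the pair of
  preimages.\<close>

lemma local_metric_warped_product:
  assumes F: "riemannian_manifold F" "c \<in> charts F"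
    and y: "base_part y \<in> upper_half_space N" "fibre_part y \<in> cimage F c"
  shows "local_metric (warped_product (hyperbolic_space N) f F) ((), c) y
    = warped_metric (hyperbolic_metric N) f (local_metric F c) y"
proof -
  let ?M = "warped_product (hyperbolic_space N) f F"
  let ?p = "cinv F c (fibre_part y)"
  have p: "?p \<in> cdom F c" "coord F c ?p = fibre_part y"
    using y(2) by (auto simp: cinv_def cimage_def inv_into_into f_inv_into_f)
  have "inj_on (coord ?M ((), c)) (cdom ?M ((), c))"
  proof (rule inj_onI)
    fix r s assume rs: "r \<in> cdom ?M ((), c)" "s \<in> cdom ?M ((), c)" "coord ?M ((), c) r = coord ?M ((), c) s"
    then have "base_part (coord ?M ((), c) r) = base_part (coord ?M ((), c) s)"
      "fibre_part (coord ?M ((), c) r) = fibre_part (coord ?M ((), c) s)" by simp_all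
    then have "fst r = fst s" "coord F c (snd r) = coord F c (snd s)"
      by (simp_all add: warped_product_def hyperbolic_space_def base_part_def fibre_part_def case_prod_beta)
    then show "r = s"
      using rs inj_onD[OF riemannian_coord_inj_on[OF F]]
      by (auto simp: warped_product_def prod_eq_iff)
  qed
  moreover have "(base_part y, ?p) \<in> cdom ?M ((), c)"
    using p y by (simp add: warped_product_def hyperbolic_space_def)
  moreover have "coord ?M ((), c) (base_part y, ?p) = y"
    using p(2) by (auto simp: warped_product_def hyperbolic_space_def vec_eq_iff base_part_def fibre_part_def split: sum.split)
  ultimately have "cinv ?M ((), c) y = (base_part y, ?p)"
    unfolding cinv_def by (metis inv_into_f_f)
  then have "local_metric ?M ((), c) y = metric ?M ((), c) (base_part y, ?p)"
    by (simp add: local_metric_def)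
  then show ?thesis
    by (simp add: local_metric_def warped_metric_def warped_product_def hyperbolic_space_def hyperbolic_metric_def
        vec_eq_iff split: sum.split)
qed

lemma cimage_warped_product:
  "cimage (warped_product (hyperbolic_space N) f F) ((), c)
    = {y. base_part y \<in> upper_half_space N \<and> fibre_part y \<in> cimage F c}" (is "?L = ?R")
proof
  show "?L \<subseteq> ?R"
    by (auto simp: cimage_def warped_product_def hyperbolic_space_def base_part_def fibre_part_def)
  show "?R \<subseteq> ?L"
  proof
    fix y :: "real^('a + 'b)" assume y: "y \<in> ?R"
    then obtain p where p: "p \<in> cdom F c" "fibre_part y = coord F c p" by (auto simp: cimage_def)
    have "coord F c p $ b = y $ Inr b" for b by (simp add: p(2)[symmetric] fibre_part_def)
    then have "y = coord (warped_product (hyperbolic_space N) f F) ((), c) (base_part y, p)"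
      by (auto simp: warped_product_def hyperbolic_space_def vec_eq_iff base_part_def split: sum.split)
    moreover have "(base_part y, p) \<in> cdom (warped_product (hyperbolic_space N) f F) ((), c)"
      using p y by (simp add: warped_product_def hyperbolic_space_def)
    ultimately show "y \<in> ?L" unfolding cimage_def by (rule image_eqI)
  qed
qed

lemma warped_chart_hyperbolic:
  assumes F: "riemannian_manifold F" "c \<in> charts F"
    and f: "smooth_on (upper_half_space N) f" "\<forall>x\<in>upper_half_space N. f x > 0"
  shows "warped_chart (hyperbolic_metric N) (local_metric F c) f (upper_half_space N) (cimage F c)"
proof
  show "open (cimage F c)" "\<And>a b. smooth_on (cimage F c) (\<lambda>z. local_metric F c z $ a $ b)"
    using F by (auto simp: riemannian_manifold_def smooth_manifold_def)
  fix z assume "z \<in> cimage F c"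
  then have "cinv F c z \<in> cdom F c"
    by (simp add: cinv_def cimage_def inv_into_into)
  then show "transpose (local_metric F c z) = local_metric F c z" "invertible (local_metric F c z)"
    using F by (auto simp: local_metric_def riemannian_manifold_def intro!: pos_def_invertible)
qed (use f in \<open>auto simp: open_upper_half_space smooth_on_hyperbolic_metric invertible_hyperbolic_metric order_less_imp_not_eq2\<close>)

text \<open>The mixed blocks vanish on both sides, the base block is the Hessian equation, and the
  fibre block is a scalar equation multiplied by the metric of the fibre.\<close>

lemma einstein_warped_product_iff:
  fixes N :: "'n::finite" and F :: "('p, 'c, 'd::finite) riemannian"
  assumes F: "riemannian_manifold F" "einstein F lamF"
    and f: "smooth_on (upper_half_space N) f" "\<forall>x\<in>upper_half_space N. f x > 0"
  shows "einstein (warped_product (hyperbolic_space N) f F) lam \<longleftrightarrow>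
    (\<forall>x\<in>upper_half_space N.
      (\<forall>b c. real CARD('d) * hessian (hyperbolic_metric N) f b c x
          = - (lam + real CARD('n) - 1) * f x * hyperbolic_metric N x $ b $ c) \<and>
      lamF = lam * (f x)\<^sup>2 + (x $ N)\<^sup>2 * (f x * (\<Sum>a\<in>UNIV. hessian (hyperbolic_metric N) f a a x)
        + (real CARD('d) - 1) * (\<Sum>a\<in>UNIV. (partial_deriv a f x)\<^sup>2)))" (is "_ \<longleftrightarrow> (\<forall>x\<in>_. ?base x \<and> ?fibre x)")
proof -
  let ?M = "warped_product (hyperbolic_space N) f F"
  define P where "P x \<longleftrightarrow> ?base x \<and> ?fibre x" for x
  have charts: "charts ?M = {()} \<times> charts F"
    by (simp add: warped_product_def hyperbolic_space_def)
  have pointwise: "(\<forall>i j. ricci (local_metric ?M ((), c)) i j y = lam * local_metric ?M ((), c) y $ i $ j)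
      \<longleftrightarrow> P (base_part y)"
    if c: "c \<in> charts F" and y: "base_part y \<in> upper_half_space N" "fibre_part y \<in> cimage F c" for c y
  proof -
    let ?x = "base_part y" and ?z = "fibre_part y" and ?g = "local_metric F c" and ?h = "hyperbolic_metric N"
    interpret warped_chart ?h ?g f "upper_half_space N" "cimage F c"
      by (rule warped_chart_hyperbolic[OF F(1) c f])
    have yU: "y \<in> U" using y by (simp add: U_def)
    have fx: "f ?x > 0" using f y by blast
    have M: "local_metric ?M ((), c) z = W z" if "z \<in> U" for z
      by (rule local_metric_warped_product[OF F(1) c U_D[OF that]])
    have ricF: "ricci ?g a b ?z = lamF * ?g ?z $ a $ b" for a b
      using F(2) c y by (simp add: einstein_def)
    \<comment> \<open>Positive definiteness gives nonzero diagonal entries, by which the fibre block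
      can be divided.\<close>
    have g0: "?g ?z $ \<beta> $ \<beta> \<noteq> 0" for \<beta>
    proof -
      have "cinv F c ?z \<in> cdom F c" using y(2) by (simp add: cinv_def cimage_def inv_into_into)
      then have "axis \<beta> 1 \<bullet> (?g ?z *v axis \<beta> 1) > 0"
        using F(1) c unfolding riemannian_manifold_def local_metric_def by (metis axis_eq_0_iff one_neq_zero)
      then show ?thesis by (simp add: matrix_vector_mul_component inner_axis inner_axis')
    qed
    have base: "(ricci W (Inl a) (Inl b) y = lam * W y $ Inl a $ Inl b) \<longleftrightarrow>
       real CARD('d) * hessian ?h f a b ?x = - (lam + real CARD('n) - 1) * f ?x * ?h ?x $ a $ b" for a b
      using fx unfolding ricci_W_base[OF yU] ricci_hyperbolic[OF y(1)]
      by (simp add: field_simps) argo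
    have fibre: "(ricci W (Inr \<alpha>) (Inr \<beta>) y = lam * W y $ Inr \<alpha> $ Inr \<beta>) \<longleftrightarrow> ?g ?z $ \<alpha> $ \<beta> = 0 \<or> ?fibre ?x" for \<alpha> \<beta>
    proof -
      have factor: "r = s \<longleftrightarrow> t = 0 \<or> u = v" if "r - s = t * (u - v)" for r s t u v :: real
        using that by (metis eq_iff_diff_eq_0 mult_eq_0_iff)
      have "(\<Sum>a\<in>UNIV. partial_deriv a f ?x * gradient ?h f a ?x) = (?x $ N)\<^sup>2 * (\<Sum>a\<in>UNIV. (partial_deriv a f ?x)\<^sup>2)"
        by (simp add: gradient_hyperbolic[OF y(1)] sum_distrib_left power2_eq_square mult_ac)
      then have "ricci W (Inr \<alpha>) (Inr \<beta>) y - lam * W y $ Inr \<alpha> $ Inr \<beta> = ?g ?z $ \<alpha> $ \<beta> *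
        (lamF - (lam * (f ?x)\<^sup>2 + (?x $ N)\<^sup>2 * (f ?x * (\<Sum>a\<in>UNIV. hessian ?h f a a ?x)
          + (real CARD('d) - 1) * (\<Sum>a\<in>UNIV. (partial_deriv a f ?x)\<^sup>2))))"
        unfolding ricci_W_fibre[OF yU] ricF divergence_hyperbolic[OF y(1) f(1)]
        by (simp add: algebra_simps)
      then show ?thesis by (rule factor)
    qed
    have "(\<forall>i j. ricci (local_metric ?M ((), c)) i j y = lam * local_metric ?M ((), c) y $ i $ j)
      \<longleftrightarrow> (\<forall>i j. ricci W i j y = lam * W y $ i $ j)"
      using ricci_transform_open[OF open_U yU M] M[OF yU] by simp
    also have "\<dots> \<longleftrightarrow> P ?x"
      unfolding P_def split_sum_all base fibre using ricci_W_mixed[OF yU] g0 by auto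
    finally show ?thesis .
  qed
  \<comment> \<open>A point of the fibre exists, and base and fibre coordinates can be prescribed
    independently; so the condition at all points of product charts reaches every point of the
    half-space.\<close>
  have ex: "\<exists>c\<in>charts F. \<exists>z. z \<in> cimage F c"
  proof -
    have "(\<Union>c\<in>charts F. cdom F c) \<noteq> {}"
      using F(1) unfolding riemannian_manifold_def smooth_manifold_def by metis
    then show ?thesis by (auto simp: cimage_def)
  qed
  have surj: "\<exists>y :: real^('n + 'd). base_part y = x \<and> fibre_part y = z" for x z
    by (rule exI[of _ "\<chi> i. case i of Inl a \<Rightarrow> x $ a | Inr b \<Rightarrow> z $ b"])
       (simp add: base_part_def fibre_part_def)
  have "einstein ?M lam \<longleftrightarrow> (\<forall>c\<in>charts F. \<forall>y. base_part y \<in> upper_half_space N \<and> fibre_part y \<in> cimage F c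
      \<longrightarrow> P (base_part y))"
    unfolding einstein_def charts using pointwise by (simp add: cimage_warped_product)
  also have "\<dots> \<longleftrightarrow> (\<forall>x\<in>upper_half_space N. P x)"
    using ex surj by metis
  finally show ?thesis by (simp only: P_def)
qed

section \<open>Functions with scalar Hessian\<close>

definition quadratic :: "real \<Rightarrow> ('n::finite \<Rightarrow> real) \<Rightarrow> real \<Rightarrow> real^'n \<Rightarrow> real" where
  "quadratic A \<beta> C x = A / 2 * (\<Sum>i\<in>UNIV. (x $ i)\<^sup>2) + (\<Sum>i\<in>UNIV. \<beta> i * x $ i) + C"

lemma differentiable_quadratic [simp]: "quadratic A \<beta> C differentiable at x"
proof -
  have "(\<lambda>x. quadratic A \<beta> C x) differentiable at x"
    unfolding quadratic_def by (intro differentiable_add differentiable_mult differentiable_sum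
        differentiable_power differentiable_const differentiable_nth ballI finite)
  then show ?thesis by simp
qed

lemma partial_deriv_quadratic: "partial_deriv c (quadratic A \<beta> C) x = A * x $ c + \<beta> c"
proof -
  have sq: "partial_deriv c (\<lambda>x. (x $ i)\<^sup>2) x = 2 * (x $ i) * of_bool (c = i)" for i
    using partial_deriv_mult[OF differentiable_nth differentiable_nth, of c i i x]
    by (simp add: power2_eq_square partial_deriv_nth)
  have "partial_deriv c (\<lambda>x. quadratic A \<beta> C x) x = A / 2 * (\<Sum>i\<in>UNIV. 2 * (x $ i) * of_bool (c = i)) + (\<Sum>i\<in>UNIV. \<beta> i * of_bool (c = i))"
    unfolding quadratic_def
    by (simp add: partial_deriv_add partial_deriv_cmult partial_deriv_sum sq partial_deriv_nth
        del: sum_mult_of_bool_eq times_divide_eq_left)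
  then show ?thesis by (simp add: of_bool_if_distribs cong: if_cong)
qed

text \<open>Here \<open>p c\<close> stands for an explicit expression that equals the partial
  derivative of \<open>u\<close> on the half-space, so that second derivatives can be taken of that
  expression.\<close>

lemma quadratic_if_hessian_scalar:
  fixes u :: "real^'n::finite \<Rightarrow> real"
  assumes card: "CARD('n) \<ge> 2"
    and u: "\<And>x. x \<in> upper_half_space N \<Longrightarrow> u differentiable at x"
    and du: "\<And>x c. x \<in> upper_half_space N \<Longrightarrow> partial_deriv c u x = p c x"
    and p: "\<And>x c. x \<in> upper_half_space N \<Longrightarrow> p c differentiable at x"
    and dp: "\<And>x b c. x \<in> upper_half_space N \<Longrightarrow> partial_deriv b (p c) x = of_bool (b = c) * w x"
  obtains A \<beta> C where "\<And>x. x \<in> upper_half_space N \<Longrightarrow> w x = A"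
    "\<And>x c. x \<in> upper_half_space N \<Longrightarrow> p c x = A * x $ c + \<beta> c"
    "\<And>x. x \<in> upper_half_space N \<Longrightarrow> u x = quadratic A \<beta> C x"
proof -
  let ?H = "upper_half_space N"
  note HS = open_upper_half_space[of N] convex_upper_half_space[of N]
  have p_eq: "p c x = p c y" if "x \<in> ?H" "y \<in> ?H" "x $ c = y $ c" for x y c
    by (rule eq_if_partial_derivs_zero[OF HS p, where J = "{c}"]) (use that dp in auto)
  have w_eq: "w x = w y" if xy: "x \<in> ?H" "y \<in> ?H" "x $ c = y $ c" for x y c
  proof -
    \<comment> \<open>\<open>w\<close> is the derivative of \<open>p c\<close> in direction
      \<open>c\<close>. At two points with equal coordinate \<open>c\<close>, the functions
      \<open>p c\<close> agree along short parallel segments in that direction, hence so do their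
      derivatives.\<close>
    have D: "((\<lambda>t. p c (z + t *\<^sub>R axis c 1)) has_real_derivative w z) (at 0)" if "z \<in> ?H" for z
      using has_real_derivative_along_axis[OF p[OF that, of c], of c] dp[OF that, of c c] by simp
    have ev: "\<forall>\<^sub>F t in nhds (0::real). z + t *\<^sub>R axis c 1 \<in> ?H" if "z \<in> ?H" for z
    proof -
      have "((\<lambda>t::real. z + t *\<^sub>R axis c 1) \<longlongrightarrow> z + 0 *\<^sub>R axis c 1) (nhds 0)"
        by (intro tendsto_intros filterlim_ident)
      then show ?thesis using topological_tendstoD HS(1) that by fastforce
    qed
    have E: "\<forall>\<^sub>F t in nhds 0. p c (x + t *\<^sub>R axis c 1) = p c (y + t *\<^sub>R axis c 1)"
      using ev[OF xy(1)] ev[OF xy(2)] by eventually_elim (rule p_eq, use xy(3) in auto)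
    have "((\<lambda>t. p c (y + t *\<^sub>R axis c 1)) has_real_derivative w x) (at 0)"
      using DERIV_cong_ev[OF refl E refl] D[OF xy(1)] by (rule iffD1)
    then show ?thesis using D[OF xy(2)] DERIV_unique by blast
  qed
  define x0 :: "real^'n" where "x0 = (\<chi> i. 1)"
  have x0: "x0 \<in> ?H" by (simp add: x0_def upper_half_space_def)
  obtain c :: 'n where c: "c \<noteq> N"
    using card by (metis (full_types) UNIV_I card_1_singleton_iff card_le_Suc0_iff_eq finite not_less_eq_eq numeral_2_eq_2)
  define A where "A = w x0"
  have w: "w x = A" if x: "x \<in> ?H" for x
  proof -
    \<comment> \<open>The intermediate point shares coordinate \<open>N\<close> with
      \<open>x\<close> and coordinate \<open>c\<close> with \<open>x0\<close>, so two applications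
      of \<open>w_eq\<close> link \<open>w x\<close> to \<open>w x0\<close>.\<close>
    have z: "(\<chi> i. if i = N then x $ N else x0 $ i) \<in> ?H" (is "?z \<in> _")
      using x by (simp add: upper_half_space_def)
    have "w x = w ?z" by (rule w_eq[OF x z, of N]) simp
    also have "\<dots> = w x0" by (rule w_eq[OF z x0, of c]) (use c in simp)
    finally show ?thesis by (simp only: A_def)
  qed
  define \<beta> where "\<beta> c = p c x0 - A * x0 $ c" for c
  have pA: "p c x = A * x $ c + \<beta> c" if x: "x \<in> ?H" for x c
  proof -
    have "p c x - A * x $ c = p c x0 - A * x0 $ c"
      by (rule eq_if_partial_derivs_zero[OF HS, where J = "{}" and h = "\<lambda>x. p c x - A * x $ c"])
         (use x x0 p dp w in \<open>auto simp: partial_deriv_diff partial_deriv_cmult partial_deriv_nth\<close>)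
    then show ?thesis by (simp add: \<beta>_def)
  qed
  define C where "C = u x0 - quadratic A \<beta> 0 x0"
  have "u x - quadratic A \<beta> 0 x = C" if x: "x \<in> ?H" for x
    unfolding C_def
    by (rule eq_if_partial_derivs_zero[OF HS, where J = "{}" and h = "\<lambda>x. u x - quadratic A \<beta> 0 x"])
       (use x x0 u du pA in \<open>auto simp: partial_deriv_diff partial_deriv_quadratic\<close>)
  then have "u x = quadratic A \<beta> C x" if x: "x \<in> ?H" for x
    using x by (force simp: quadratic_def)
  with w pA show thesis by (rule that)
qed

section \<open>The substitution \<open>x $ N * f x\<close> and its quadratic solutions\<close>

lemma partial_deriv_nth_mult:
  assumes "f differentiable at x"
  shows "partial_deriv c (\<lambda>x. x $ N * f x) x = x $ N * partial_deriv c f x + of_bool (c = N) * f x"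
  using assms by (simp add: partial_deriv_mult partial_deriv_nth)

text \<open>The left side is a second derivative of \<open>x $ N * f x\<close>. The factor
  \<open>x $ N\<close> absorbs the first-order terms of the hyperbolic Hessian, except for the
  diagonal one.\<close>

lemma partial_deriv_nth_mult_hessian:
  assumes x: "x \<in> upper_half_space N" and f: "smooth_on (upper_half_space N) f"
  shows "partial_deriv b (\<lambda>x. x $ N * partial_deriv c f x + of_bool (c = N) * f x) x
    = x $ N * hessian (hyperbolic_metric N) f b c x + of_bool (b = c) * partial_deriv N f x"
proof -
  have fd: "f differentiable at x" "\<And>b. partial_deriv b f differentiable at x"
    using f smooth_on_differentiable smooth_on_partial_deriv x by blast+
  show ?thesis
    using upper_half_space_nth_pos[OF x] fd
    by (simp add: hessian_hyperbolic[OF x] partial_deriv_add partial_deriv_mult partial_deriv_nth field_simps)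
qed

text \<open>Both parts come from differentiating \<open>sol\<close>: the Hessian from second
  derivatives, the gradient norm from squaring the first ones.\<close>

lemma quadratic_solution:
  assumes f: "smooth_on (upper_half_space N) f"
    and sol: "\<And>x. x \<in> upper_half_space N \<Longrightarrow> x $ N * f x = quadratic A \<beta> C x"
    and \<beta>: "\<beta> N = 0" and x: "x \<in> upper_half_space N"
  shows "hessian (hyperbolic_metric N) f b c x = f x * hyperbolic_metric N x $ b $ c"
    and "(x $ N)\<^sup>2 * (\<Sum>a\<in>UNIV. (partial_deriv a f x)\<^sup>2) = (f x)\<^sup>2 + (\<Sum>a\<in>UNIV. (\<beta> a)\<^sup>2) - 2 * A * C"
proof -
  have 1: "z $ N * partial_deriv c f z + of_bool (c = N) * f z = A * z $ c + \<beta> c" if z: "z \<in> upper_half_space N" for c z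
  proof -
    have "partial_deriv c (\<lambda>x. x $ N * f x) z = partial_deriv c (quadratic A \<beta> C) z"
      by (rule partial_deriv_transform_open[OF open_upper_half_space z sol])
    then show ?thesis
      unfolding partial_deriv_nth_mult[OF smooth_on_differentiable[OF f z]] partial_deriv_quadratic .
  qed
  have "x $ N * hessian (hyperbolic_metric N) f b c x + of_bool (b = c) * partial_deriv N f x
    = partial_deriv b (\<lambda>z. A * z $ c + \<beta> c) x"
    unfolding partial_deriv_nth_mult_hessian[OF x f, symmetric]
    by (rule partial_deriv_transform_open[OF open_upper_half_space x 1])
  also have "\<dots> = A * of_bool (b = c)"
    by (simp add: partial_deriv_add partial_deriv_cmult partial_deriv_nth)
  finally have "x $ N * hessian (hyperbolic_metric N) f b c x = of_bool (b = c) * (A - partial_deriv N f x)"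
    by (simp add: algebra_simps)
  then have "x $ N * (x $ N * hessian (hyperbolic_metric N) f b c x) = of_bool (b = c) * (x $ N * (A - partial_deriv N f x))"
    by (simp only: mult.left_commute)
  \<comment> \<open>This is the first-derivative identity in direction \<open>N\<close>; it uses
    that the linear coefficient of that coordinate is zero.\<close>
  also have "x $ N * (A - partial_deriv N f x) = f x"
    using 1[OF x, of N] \<beta> by (simp add: algebra_simps)
  finally show "hessian (hyperbolic_metric N) f b c x = f x * hyperbolic_metric N x $ b $ c"
    using upper_half_space_nth_pos[OF x] by (simp add: hyperbolic_metric_nth field_simps power2_eq_square)
  have "(x $ N)\<^sup>2 * (\<Sum>a\<in>UNIV. (partial_deriv a f x)\<^sup>2) = (\<Sum>a\<in>UNIV. (A * x $ a + \<beta> a - of_bool (a = N) * f x)\<^sup>2)"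
    unfolding 1[OF x, symmetric] by (simp add: sum_distrib_left power_mult_distrib)
  also have "\<dots> = (\<Sum>a\<in>UNIV. A\<^sup>2 * (x $ a)\<^sup>2 + 2 * A * (\<beta> a * x $ a) + (\<beta> a)\<^sup>2
      + of_bool (a = N) * ((f x)\<^sup>2 - 2 * f x * (A * x $ a + \<beta> a)))"
    by (intro sum.cong) (auto simp: power2_eq_square algebra_simps)
  also have "\<dots> = A\<^sup>2 * (\<Sum>a\<in>UNIV. (x $ a)\<^sup>2) + 2 * A * (\<Sum>a\<in>UNIV. \<beta> a * x $ a) + (\<Sum>a\<in>UNIV. (\<beta> a)\<^sup>2)
      + ((f x)\<^sup>2 - 2 * A * (x $ N * f x))"
    using \<beta> by (simp add: sum.distrib sum_distrib_left of_bool_if_distribs cong: if_cong)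
  \<comment> \<open>Inserting the quadratic for \<open>x $ N * f x\<close> cancels every term that
    involves the coordinates explicitly.\<close>
  also have "\<dots> = (f x)\<^sup>2 + (\<Sum>a\<in>UNIV. (\<beta> a)\<^sup>2) - 2 * A * C"
    unfolding sol[OF x] quadratic_def by (simp add: algebra_simps power2_eq_square)
  finally show "(x $ N)\<^sup>2 * (\<Sum>a\<in>UNIV. (partial_deriv a f x)\<^sup>2) = (f x)\<^sup>2 + (\<Sum>a\<in>UNIV. (\<beta> a)\<^sup>2) - 2 * A * C" .
qed

lemma hessian_hyperbolic_constant:
  assumes x: "x \<in> upper_half_space N" and "\<And>z. z \<in> upper_half_space N \<Longrightarrow> f z = C"
  shows "partial_deriv a f x = 0" "hessian (hyperbolic_metric N) f b c x = 0"
proof -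
  have 0: "partial_deriv a f z = 0" if "z \<in> upper_half_space N" for a z
    using partial_deriv_transform_open[OF open_upper_half_space that assms(2)] by simp
  then have "partial_deriv b (partial_deriv c f) x = 0"
    using partial_deriv_transform_open[OF open_upper_half_space x 0] by simp
  with 0 x show "partial_deriv a f x = 0" "hessian (hyperbolic_metric N) f b c x = 0"
    by (simp_all add: hessian_def)
qed

lemma trace_hyperbolic_metric:
  "x \<in> upper_half_space N \<Longrightarrow> (x $ N)\<^sup>2 * (\<Sum>a\<in>UNIV. hyperbolic_metric N x $ a $ a) = real CARD('n)"
  for x :: "real^'n::finite"
  using upper_half_space_nth_pos[of x N] by (simp add: hyperbolic_metric_nth)

text \<open>The formula for \<open>f\<close> amounts to the Hessian equation with
  \<open>k = 1\<close>; the condition on \<open>lamF\<close> is the remaining fibre equation, and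
  for \<open>d = 1\<close> it reads \<open>lamF = 0\<close>. The hypothesis for
  \<open>lamF < 0\<close> excludes constant \<open>f\<close>, which could solve both equations
  without having the stated form.\<close>

theorem theorem2p5:
  fixes N :: "'n::finite"
    and F :: "('p, 'c, 'd::finite) riemannian"
    and lamF :: real
    and f :: "real^'n \<Rightarrow> real"
  assumes "CARD('n) \<ge> 3"
    and "riemannian_manifold F"
    and "einstein F lamF"
    and "smooth_on (upper_half_space N) f"
    and "\<forall>x\<in>upper_half_space N. f x > 0"
    and "lamF < 0 \<Longrightarrow> \<not> f constant_on upper_half_space N"
  shows "(\<exists>lam<0. einstein (warped_product (hyperbolic_space N) f F) lam) \<longleftrightarrow>
    (\<exists>(a::real) (b::real) (bs::'n \<Rightarrow> real) (cs::'n \<Rightarrow> real).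
       (\<forall>x\<in>upper_half_space N.
          f x = 1 / x $ N * (\<Sum>j\<in>UNIV - {N}. a / 2 * (x $ j)\<^sup>2 + bs j * x $ j + cs j)
                + a / 2 * x $ N + b / x $ N) \<and>
       lamF = (real CARD('d) - 1) *
              ((\<Sum>j\<in>UNIV - {N}. (bs j)\<^sup>2) - 2 * a * (b + (\<Sum>j\<in>UNIV - {N}. cs j))))"
    (is "?einstein \<longleftrightarrow> (\<exists>a b bs cs. (\<forall>x\<in>_. ?form a b bs cs x) \<and> ?fibre a b bs cs)")
proof -
  let ?H = "upper_half_space N" and ?h = "hyperbolic_metric N"
  let ?n = "real CARD('n)" and ?d = "real CARD('d)"
  note f = assms(4) and pos = assms(5)
  note iff = einstein_warped_product_iff[OF assms(2-5)]
  \<comment> \<open>Multiplied by \<open>x $ N\<close>, the formula is a quadratic without linear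
    term in the last coordinate; \<open>b\<close> and all \<open>cs j\<close> merge into one
    constant.\<close>
  have form: "?form a b bs cs x \<longleftrightarrow> x $ N * f x = quadratic a (bs(N := 0)) (b + (\<Sum>j\<in>UNIV - {N}. cs j)) x"
    if "x \<in> ?H" for a b bs cs x
  proof -
    have "(\<Sum>j\<in>UNIV. \<phi> j) = \<phi> N + (\<Sum>j\<in>UNIV - {N}. \<phi> j)" for \<phi> :: "'n \<Rightarrow> real"
      by (simp add: sum.remove)
    moreover have "(\<Sum>j\<in>UNIV - {N}. (bs(N := 0)) j * x $ j) = (\<Sum>j\<in>UNIV - {N}. bs j * x $ j)"
      by (intro sum.cong) auto
    ultimately have q: "quadratic a (bs(N := 0)) (b + (\<Sum>j\<in>UNIV - {N}. cs j)) x =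
      (\<Sum>j\<in>UNIV - {N}. a / 2 * (x $ j)\<^sup>2 + bs j * x $ j + cs j) + a / 2 * (x $ N)\<^sup>2 + b"
      by (simp add: quadratic_def sum.distrib sum_distrib_left sum_divide_distrib algebra_simps)
    show ?thesis
      unfolding q using upper_half_space_nth_pos[OF that] by (simp add: field_simps power2_eq_square)
  qed
  have fibre: "?fibre a b bs cs \<longleftrightarrow> lamF = (?d - 1) * ((\<Sum>j\<in>UNIV. ((bs(N := 0)) j)\<^sup>2) - 2 * a * (b + (\<Sum>j\<in>UNIV - {N}. cs j)))"
    for a b bs cs
  proof -
    have "(\<Sum>j\<in>UNIV. ((bs(N := 0)) j)\<^sup>2) = (\<Sum>j\<in>UNIV - {N}. (bs j)\<^sup>2)"
      by (simp add: sum.remove[of UNIV N])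
    then show ?thesis by simp
  qed
  \<comment> \<open>\<open>lam = 1 - n - d\<close> is the value for which \<open>k = 1\<close>. The
    terms in \<open>(f x)\<^sup>2\<close> then cancel: \<open>lam\<close> from the metric,
    \<open>n\<close> from the Laplacian, \<open>d - 1\<close> from the gradient.\<close>
  have solution: "?d * hessian ?h f b c x = - (lam + ?n - 1) * f x * ?h x $ b $ c"
    "lam * (f x)\<^sup>2 + (x $ N)\<^sup>2 * (f x * (\<Sum>a\<in>UNIV. hessian ?h f a a x)
        + (?d - 1) * (\<Sum>a\<in>UNIV. (partial_deriv a f x)\<^sup>2)) = (?d - 1) * ((\<Sum>j\<in>UNIV. (\<beta> j)\<^sup>2) - 2 * A * C)"
    if sol: "\<And>x. x \<in> ?H \<Longrightarrow> x $ N * f x = quadratic A \<beta> C x" and "\<beta> N = 0" "x \<in> ?H" "lam = 1 - ?n - ?d"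
    for A \<beta> C x lam b c
  proof -
    have hess: "hessian ?h f b c x = f x * ?h x $ b $ c" for b c
      by (rule quadratic_solution(1)[OF f sol that(2,3)])
    have grad: "(x $ N)\<^sup>2 * (\<Sum>a\<in>UNIV. (partial_deriv a f x)\<^sup>2) = (f x)\<^sup>2 + (\<Sum>a\<in>UNIV. (\<beta> a)\<^sup>2) - 2 * A * C"
      by (rule quadratic_solution(2)[OF f sol that(2,3)])
    show "?d * hessian ?h f b c x = - (lam + ?n - 1) * f x * ?h x $ b $ c"
      unfolding hess that(4) by simp
    have "lam * (f x)\<^sup>2 + (x $ N)\<^sup>2 * (f x * (\<Sum>a\<in>UNIV. hessian ?h f a a x)
        + (?d - 1) * (\<Sum>a\<in>UNIV. (partial_deriv a f x)\<^sup>2))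
      = lam * (f x)\<^sup>2 + (f x)\<^sup>2 * ((x $ N)\<^sup>2 * (\<Sum>a\<in>UNIV. ?h x $ a $ a))
        + (?d - 1) * ((x $ N)\<^sup>2 * (\<Sum>a\<in>UNIV. (partial_deriv a f x)\<^sup>2))"
      unfolding hess by (simp add: sum_distrib_left[symmetric] algebra_simps power2_eq_square)
    also have "\<dots> = (?d - 1) * ((\<Sum>j\<in>UNIV. (\<beta> j)\<^sup>2) - 2 * A * C)"
      unfolding grad trace_hyperbolic_metric[OF that(3)] that(4) by (simp add: algebra_simps)
    finally show "lam * (f x)\<^sup>2 + (x $ N)\<^sup>2 * (f x * (\<Sum>a\<in>UNIV. hessian ?h f a a x)
        + (?d - 1) * (\<Sum>a\<in>UNIV. (partial_deriv a f x)\<^sup>2)) = (?d - 1) * ((\<Sum>j\<in>UNIV. (\<beta> j)\<^sup>2) - 2 * A * C)" .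
  qed
  show ?thesis
  proof
    assume "\<exists>a b bs cs. (\<forall>x\<in>?H. ?form a b bs cs x) \<and> ?fibre a b bs cs"
    then obtain a b bs cs where sol: "\<forall>x\<in>?H. ?form a b bs cs x" and fibre': "?fibre a b bs cs"
      by (elim exE conjE) (rule that)
    have sol: "x $ N * f x = quadratic a (bs(N := 0)) (b + (\<Sum>j\<in>UNIV - {N}. cs j)) x" if "x \<in> ?H" for x
      by (rule form[THEN iffD1, OF that bspec[OF sol that]])
    have "einstein (warped_product (hyperbolic_space N) f F) (1 - ?n - ?d)"
      unfolding iff
    proof (intro ballI conjI allI)
      fix x b c assume x: "x \<in> ?H"
      show "?d * hessian ?h f b c x = - (1 - ?n - ?d + ?n - 1) * f x * ?h x $ b $ c"
        by (rule solution(1)[OF sol fun_upd_same x refl])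
      show "lamF = (1 - ?n - ?d) * (f x)\<^sup>2 + (x $ N)\<^sup>2 * (f x * (\<Sum>a\<in>UNIV. hessian ?h f a a x)
        + (?d - 1) * (\<Sum>a\<in>UNIV. (partial_deriv a f x)\<^sup>2))"
        by (subst solution(2)[OF sol fun_upd_same x refl], assumption) (rule fibre'[unfolded fibre])
    qed
    moreover have "1 - ?n - ?d < 0" using assms(1) by simp
    ultimately show ?einstein by blast
  next
    assume ?einstein
    then obtain lam where lam: "lam < 0" and ein: "einstein (warped_product (hyperbolic_space N) f F) lam"
      by blast
    note eqs = bspec[OF iff[THEN iffD1, OF ein]]
    have base: "?d * hessian ?h f b c x = - (lam + ?n - 1) * f x * ?h x $ b $ c" if "x \<in> ?H" for x b c
      by (rule eqs[OF that, THEN conjunct1, THEN spec, THEN spec])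
    have fib: "lamF = lam * (f x)\<^sup>2 + (x $ N)\<^sup>2 * (f x * (\<Sum>a\<in>UNIV. hessian ?h f a a x)
        + (?d - 1) * (\<Sum>a\<in>UNIV. (partial_deriv a f x)\<^sup>2))" if "x \<in> ?H" for x
      by (rule eqs[OF that, THEN conjunct2])
    define k where "k = - (lam + ?n - 1) / ?d"
    have hess: "hessian ?h f b c x = k * f x * ?h x $ b $ c" if "x \<in> ?H" for x b c
      using base[OF that, of b c] by (simp add: k_def field_simps)
    define w where "w x = partial_deriv N f x + k * f x / x $ N" for x
    have fd: "f differentiable at x" "\<And>b. partial_deriv b f differentiable at x" if "x \<in> ?H" for x
      using f smooth_on_differentiable smooth_on_partial_deriv that by blast+
    obtain A \<beta> C where A: "\<And>x. x \<in> ?H \<Longrightarrow> w x = A"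
      and p: "\<And>x c. x \<in> ?H \<Longrightarrow> x $ N * partial_deriv c f x + of_bool (c = N) * f x = A * x $ c + \<beta> c"
      and q: "\<And>x. x \<in> ?H \<Longrightarrow> x $ N * f x = quadratic A \<beta> C x"
    proof (rule quadratic_if_hessian_scalar[of N "\<lambda>x. x $ N * f x" "\<lambda>c x. x $ N * partial_deriv c f x + of_bool (c = N) * f x" w])
      show "2 \<le> CARD('n)" using assms(1) by simp
      fix x b c assume x: "x \<in> ?H"
      show "partial_deriv b (\<lambda>x. x $ N * partial_deriv c f x + of_bool (c = N) * f x) x = of_bool (b = c) * w x"
        unfolding partial_deriv_nth_mult_hessian[OF x f] hess[OF x] w_def hyperbolic_metric_nth
        using upper_half_space_nth_pos[OF x] by (simp add: field_simps power2_eq_square)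
      show "partial_deriv c (\<lambda>x. x $ N * f x) x = x $ N * partial_deriv c f x + of_bool (c = N) * f x"
        by (rule partial_deriv_nth_mult[OF fd(1)[OF x]])
    qed (use fd in auto)
    \<comment> \<open>The difference of \<open>p\<close> in direction \<open>N\<close> and the
      equation \<open>w x = A\<close> multiplied by \<open>x $ N\<close>.\<close>
    have k: "(1 - k) * f x = \<beta> N" if x: "x \<in> ?H" for x
      using p[OF x, of N] A[OF x] upper_half_space_nth_pos[OF x] by (simp add: w_def field_simps)
    define x0 :: "real^'n" where "x0 = (\<chi> i. 1)"
    have x0: "x0 \<in> ?H" by (simp add: x0_def upper_half_space_def)
    have "k = 1"
    proof (rule ccontr)
      assume "k \<noteq> 1"
      then have const: "f x = \<beta> N / (1 - k)" if "x \<in> ?H" for x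
        using k[OF that] by (simp add: field_simps)
      \<comment> \<open>All derivatives of the constant \<open>f\<close> vanish in the fibre
        equation. With \<open>lam < 0\<close> this makes \<open>lamF\<close> negative, the case in
        which constant \<open>f\<close> is excluded.\<close>
      have "lamF = lam * (f x0)\<^sup>2"
        using fib[OF x0] hessian_hyperbolic_constant[OF x0 const] by simp
      moreover have "f x0 > 0" using pos x0 by blast
      ultimately have "lamF < 0" using lam by (simp add: mult_neg_pos)
      then show False using assms(6) const unfolding constant_on_def by blast
    qed
    then have \<beta>: "\<beta> N = 0" and lam': "lam = 1 - ?n - ?d"
      using k[OF x0] by (simp_all add: k_def field_simps)
    have \<beta>': "\<beta>(N := 0) = \<beta>" using \<beta> by auto
    have "lamF = (?d - 1) * ((\<Sum>j\<in>UNIV. (\<beta> j)\<^sup>2) - 2 * A * C)"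
      using fib[OF x0] solution(2)[OF q \<beta> x0 lam'] by simp
    \<comment> \<open>Only the sum of \<open>b\<close> and the \<open>cs j\<close> matters, so
      \<open>b = C\<close> and \<open>cs = 0\<close> serve as witnesses.\<close>
    then have fibre': "?fibre A C \<beta> (\<lambda>_. 0)" unfolding fibre \<beta>' by simp
    have form': "?form A C \<beta> (\<lambda>_. 0) x" if "x \<in> ?H" for x
      unfolding form[OF that] \<beta>' using q[OF that] by simp
    show "\<exists>a b bs cs. (\<forall>x\<in>?H. ?form a b bs cs x) \<and> ?fibre a b bs cs"
      by (rule exI[of _ A], rule exI[of _ C], rule exI[of _ \<beta>], rule exI[of _ "\<lambda>_. 0"],
          rule conjI[OF ballI[OF form'] fibre'])
  qed
qed

end
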